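(* Let $q$ be a positive integer and let $\ell$ be an odd prime power. For any integer $n\ge \max\{q,11-q\}$, the product $(1^{\ell}+q^{\ell})(2^{\ell}+q^{\ell})\cdots (n^{\ell}+q^{\ell})$ is not a powerful number.
   Context: A positive integer $t$ is called a powerful number if $t>1$ and $p^2\mid t$ for every prime divisor $p$ of $t$. An odd prime power is an integer of the form $k^s$ with $k$ an odd prime and $s$ a positive integer. *)

theory Defs
  imports "HOL-Computational_Algebra.Primes"
begin

text \<open>The number 1 is excluded here, although the usual convention counts it as powerful.\<close>

definition powerful_number :: "nat \<Rightarrow> bool" where
  "powerful_number t \<longleftrightarrow> t > 1 \<and> (\<forall>p. prime p \<and> p dvd t \<longrightarrow> p\<^sup>2 dvd t)"

definition odd_prime_power :: "nat \<Rightarrow> bool" where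
  "odd_prime_power l \<longleftrightarrow> (\<exists>k s. prime k \<and> odd k \<and> s > 0 \<and> l = k ^ s)"

end

theory Submission
  imports Defs "HOL-Analysis.Harmonic_Numbers" "HOL-Number_Theory.Number_Theory"
begin

text \<open>
  Let \<open>l = k ^ s\<close>. If \<open>p\<close> is a prime with \<open>(n + q) / 2 < p \<le> n + q\<close>, \<open>p \<noteq> k\<close> and \<open>k\<close> does not
  divide \<open>p - 1\<close>, then \<open>x \<mapsto> x ^ l\<close> permutes the residues modulo \<open>p\<close>, so \<open>p\<close> divides \<open>i ^ l + q ^ l\<close>
  only if it divides \<open>i + q\<close>, i.e. only for \<open>i = p - q\<close>; and there it divides exactly once. Hence it
  suffices to find such a prime in \<open>{N<..2 * N}\<close> for \<open>N = (n + q) div 2 \<ge> 6\<close>; if \<open>n + q = 11\<close>, then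
  7 or 11 will do.

  For \<open>k = 3\<close>, the product of the \<open>m \<le> 6 * J\<close> with \<open>m mod 3 = 2\<close> divided by the product of the
  \<open>m \<le> 3 * J\<close> prime to 3 is at least \<open>4 ^ J\<close>, and up to small primes it is only divisible by primes
  \<open>p\<close> with \<open>p mod 3 = 2\<close> and \<open>(6 * J) div p mod 6 = 1\<close>. Those not in \<open>{3 * J<..6 * J}\<close> are at most
  \<open>6 * J / 7\<close>, so they contribute at most \<open>4 ^ (6 * J / 7)\<close>.

  For \<open>k \<ge> 5\<close>, the quotient of \<open>(6 * a) choose (3 * a)\<close> by \<open>(2 * a) choose a\<close> bounds the product of all
  primes in \<open>{3 * a<..6 * a}\<close> from below in the same way. The product of those that are 1 modulo \<open>k\<close>,
  hence modulo \<open>2 * k\<close>, is bounded from above by a product of \<open>h\<close> consecutive terms of the progression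
  \<open>2 * k * j + 1\<close>, divided by the part of \<open>fact h\<close> prime to \<open>2 * k\<close>. For \<open>X = 6 * a\<close> the logarithms of
  the two bounds are about \<open>0.264 * X\<close> and at most about \<open>0.241 * X\<close>.

  This settles \<open>N > 500000\<close>. For smaller \<open>N\<close> there are primes \<open>p, p'\<close> in \<open>{N<..2 * N}\<close> such that the gcd of \<open>p * (p - 1)\<close> and
  \<open>p' * (p' - 1)\<close> is a power of 2, so that \<open>k\<close> cannot exclude both of them.
\<close>

section \<open>Products over primes\<close>

lemma multiplicity_eq_card_powers:
  fixes p m N :: nat
  assumes "prime p" "m > 0" "m < p ^ N"
  shows "multiplicity p m = card {i\<in>{1..N}. p ^ i dvd m}"
proof -
  have iff: "p ^ i dvd m \<longleftrightarrow> i \<le> multiplicity p m" for i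
  proof (rule power_dvd_iff_le_multiplicity)
    show "m \<noteq> 0" "\<not> is_unit p" using assms(1,2) prime_gt_1_nat[of p] by simp_all
  qed
  have "multiplicity p m \<le> N"
  proof -
    have "p ^ multiplicity p m \<le> m"
      using assms by (intro dvd_imp_le multiplicity_dvd) auto
    hence "p ^ multiplicity p m < p ^ N"
      using assms by linarith
    thus ?thesis
      using assms(1) prime_gt_1_nat power_less_imp_less_exp less_imp_le by blast
  qed
  hence "{i\<in>{1..N}. p ^ i dvd m} = {1..multiplicity p m}"
    unfolding iff by auto
  thus ?thesis by simp
qed

text \<open>Each \<open>m\<close> contributes one for every \<open>i\<close> with
  \<open>p ^ i dvd m\<close>; exchanging the two summations counts multiples of \<open>p ^ i\<close>
  instead. The bound \<open>m < p ^ N\<close> lets the sum over \<open>i\<close> stop at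
  \<open>N\<close>.\<close>

lemma multiplicity_prod_eq_sum_card:
  fixes S :: "nat set"
  assumes "prime p" "finite S" "0 \<notin> S" "\<And>m. m \<in> S \<Longrightarrow> m < p ^ N"
  shows "multiplicity p (\<Prod>S) = (\<Sum>i\<in>{1..N}. card {m\<in>S. p ^ i dvd m})"
proof -
  have "multiplicity p (\<Prod>S) = (\<Sum>m\<in>S. multiplicity p m)"
    using assms by (intro prime_elem_multiplicity_prod_distrib) (auto intro: prime_imp_prime_elem)
  also have "\<dots> = (\<Sum>m\<in>S. \<Sum>i\<in>{1..N}. if p ^ i dvd m then 1 else 0)"
  proof (rule sum.cong[OF refl])
    fix m assume "m \<in> S"
    hence "multiplicity p m = card {i\<in>{1..N}. p ^ i dvd m}"
      using assms by (intro multiplicity_eq_card_powers) (auto intro: Nat.gr0I)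
    thus "multiplicity p m = (\<Sum>i\<in>{1..N}. if p ^ i dvd m then 1 else 0)"
      by (simp add: sum.If_cases Int_def)
  qed
  also have "\<dots> = (\<Sum>i\<in>{1..N}. \<Sum>m\<in>S. if p ^ i dvd m then 1 else 0)"
    by (rule sum.swap)
  also have "\<dots> = (\<Sum>i\<in>{1..N}. card {m\<in>S. p ^ i dvd m})"
    using assms by (simp add: sum.If_cases Int_def)
  finally show ?thesis .
qed

text \<open>Legendre's formula. The cutoff \<open>N\<close> suffices because
  \<open>n <= N < 2 ^ N <= p ^ N\<close>.\<close>

lemma multiplicity_fact_eq_sum:
  fixes p n N :: nat
  assumes "prime p" "n \<le> N"
  shows "multiplicity p (fact n) = (\<Sum>i\<in>{1..N}. n div p ^ i)"
proof -
  have "m < p ^ N" if "m \<in> {1..n}" for m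
  proof -
    have "m \<le> N" using that assms by auto
    also have "N < 2 ^ N" by (rule less_exp)
    also have "\<dots> \<le> p ^ N" using assms prime_ge_2_nat by (intro power_mono) auto
    finally show ?thesis .
  qed
  hence "multiplicity p (\<Prod>{1..n}) = (\<Sum>i\<in>{1..N}. card {m\<in>{1..n}. p ^ i dvd m})"
    using assms by (intro multiplicity_prod_eq_sum_card) auto
  also have "\<dots> = (\<Sum>i\<in>{1..N}. n div p ^ i)"
  proof (rule sum.cong[OF refl])
    fix i
    have pos: "p ^ i > 0" using assms prime_gt_0_nat by simp
    have "{m\<in>{1..n}. p ^ i dvd m} = (*) (p ^ i) ` {1..n div p ^ i}"
    proof (intro equalityI subsetI)
      fix m assume "m \<in> {m\<in>{1..n}. p ^ i dvd m}"
      then obtain c where "m = p ^ i * c" "p ^ i * c \<le> n" "c \<ge> 1" by fastforce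
      thus "m \<in> (*) (p ^ i) ` {1..n div p ^ i}"
        using pos by (auto simp: less_eq_div_iff_mult_less_eq mult.commute)
    qed (use pos in \<open>auto simp: less_eq_div_iff_mult_less_eq mult.commute\<close>)
    thus "card {m\<in>{1..n}. p ^ i dvd m} = n div p ^ i"
      using assms(1) by (simp add: card_image inj_on_def prime_gt_0_nat)
  qed
  finally show ?thesis by (simp add: fact_prod)
qed

lemma prod_primes_dvd:
  fixes n :: nat
  assumes "finite P" "\<And>p. p \<in> P \<Longrightarrow> prime p" "\<And>p. p \<in> P \<Longrightarrow> p dvd n"
  shows "\<Prod>P dvd n"
  using assms
proof (induction P rule: finite_induct)
  case (insert p P)
  have "coprime p (\<Prod>P)"
    using insert by (intro prod_coprime_right) (metis insertCI primes_coprime)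
  thus ?case using insert by (simp add: divides_mult)
qed simp

text \<open>Erdos's induction: an even \<open>n > 2\<close> is not prime, and for
  \<open>n = 2 * m + 1\<close> the primes above \<open>m + 1\<close> divide
  \<open>(2 * m + 1) choose m\<close>, which is at most \<open>4 ^ m\<close>.\<close>

lemma primorial_le:
  "(\<Prod>p | prime p \<and> p \<le> n. p) \<le> (4 :: nat) ^ n"
proof (induction n rule: less_induct)
  case (less n)
  consider "n \<le> 2" | "n > 2" "even n" | m where "m \<ge> 1" "n = 2 * m + 1"
    by (cases "even n") (force,
      metis add_cancel_left_left linorder_not_le mult_0_right not_one_le_zero oddE one_add_one
        trans_le_add2 less_one nat_less_le one_le_numeral)
  thus ?case
  proof cases
    case 1
    hence "{p. prime p \<and> p \<le> n} = (if n = 2 then {2} else {})"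
      by (auto dest: prime_ge_2_nat)
    thus ?thesis by simp
  next
    case 2
    have "p \<noteq> n" if "prime p" for p
      using that 2 primes_dvd_imp_eq two_is_prime_nat by blast
    hence "{p. prime p \<and> p \<le> n} = {p. prime p \<and> p \<le> n - 1}"
      using 2 by (auto simp: le_less)
    moreover have "(\<Prod>p | prime p \<and> p \<le> n - 1. p) \<le> (4 :: nat) ^ (n - 1)"
      using less 2 by simp
    moreover have "(4 :: nat) ^ (n - 1) \<le> 4 ^ n" by (intro power_increasing) auto
    ultimately show ?thesis by (simp only: order.trans)
  next
    case (3 m)
    let ?P = "{p. prime p \<and> m + 1 < p \<and> p \<le> 2 * m + 1}"
    have "\<Prod>?P dvd (2 * m + 1) choose m"
    proof (rule prod_primes_dvd)
      fix p assume p: "p \<in> ?P"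
      have "p dvd fact (2 * m + 1)" using p by (simp add: prime_dvd_fact_iff del: fact_Suc)
      also have "fact (2 * m + 1) = fact m * fact (m + 1) * ((2 * m + 1) choose m)"
        using binomial_fact_lemma[of m "2 * m + 1"] by simp
      finally show "p dvd (2 * m + 1) choose m"
        using p by (auto simp: prime_dvd_mult_iff prime_dvd_fact_iff simp del: fact_Suc)
    qed auto
    hence "\<Prod>?P \<le> (2 * m + 1) choose m" by (intro dvd_imp_le) auto
    also have "\<dots> \<le> 4 ^ m"
    proof -
      \<comment> \<open>The two middle coefficients are equal and belong to a row with sum
        \<open>2 ^ (2 * m + 1)\<close>.\<close>
      have "2 * ((2 * m + 1) choose m) = (\<Sum>k\<in>{m, m + 1}. (2 * m + 1) choose k)"
        using binomial_symmetric[of m "2 * m + 1"] by simp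
      also have "\<dots> \<le> (\<Sum>k\<le>2 * m + 1. (2 * m + 1) choose k)"
        by (intro sum_mono2) auto
      also have "\<dots> = 2 * 4 ^ m"
        by (subst choose_row_sum) (simp add: power_mult)
      finally show ?thesis by simp
    qed
    finally have 1: "\<Prod>?P \<le> 4 ^ m" .
    have 2: "(\<Prod>p | prime p \<and> p \<le> m + 1. p) \<le> (4 :: nat) ^ (m + 1)"
      using 3 by (intro less) simp
    have "{p. prime p \<and> p \<le> n} = ?P \<union> {p. prime p \<and> p \<le> m + 1}"
      using 3 by auto
    hence "\<Prod>{p. prime p \<and> p \<le> n} = \<Prod>(?P \<union> {p. prime p \<and> p \<le> m + 1})"
      by (rule arg_cong)
    also have "\<dots> = \<Prod>?P * (\<Prod>p | prime p \<and> p \<le> m + 1. p)"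
      by (rule prod.union_disjoint) auto
    also have "\<dots> \<le> 4 ^ m * 4 ^ (m + 1)" using 1 2 by (rule mult_le_mono)
    also have "\<dots> = 4 ^ n" using 3 by (simp add: power_add mult_2)
    finally show ?thesis by simp
  qed
qed

text \<open>\<open>A\<close> divides \<open>B\<close> times a correction for the exponents counted
  in \<open>val\<close>. If \<open>p ^ 2 > X\<close>, only \<open>i = 1\<close> can count, and then
  \<open>X div p\<close> is 1, so that \<open>p\<close> lies in the upper half of the range, or at
  least 7, where \<open>primorial_le\<close> takes over. The at most \<open>s\<close> primes with
  \<open>p ^ 2 <= X\<close> cost at most \<open>X\<close> each.\<close>

lemma quotient_le_prod_primes:
  fixes A B X s :: nat and G :: "nat \<Rightarrow> bool"
  assumes pos: "A > 0" "B > 0" "X > 0" and s: "X < (s + 1)\<^sup>2"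
    and val: "\<And>p. prime p \<Longrightarrow> multiplicity p A \<le> multiplicity p B +
                card {i\<in>{1..X}. (X div p ^ i) mod 6 = 1 \<and> (i = 1 \<longrightarrow> G p)}"
  shows "A \<le> B * (\<Prod>p | prime p \<and> X < 2 * p \<and> p \<le> X \<and> G p. p) * 4 ^ (X div 7) * X ^ s"
proof -
  define P1 where "P1 = {p. prime p \<and> X < 2 * p \<and> p \<le> X \<and> G p}"
  define P2 where "P2 = {p. prime p \<and> p \<le> X div 7}"
  define P3 where "P3 = {p. prime p \<and> p ^ 2 \<le> X}"
  define e where "e p = (GREATEST i. p ^ i \<le> X)" for p
  have e: "p ^ e p \<le> X" "\<And>i. p ^ i \<le> X \<Longrightarrow> i \<le> e p" if "prime p" for p
  proof -
    have bound: "i \<le> X" if "p ^ i \<le> X" for i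
    proof -
      have "i < 2 ^ i" by (rule less_exp)
      also have "\<dots> \<le> p ^ i" using \<open>prime p\<close> prime_ge_2_nat by (intro power_mono) auto
      finally show ?thesis using that by simp
    qed
    have "p ^ 0 \<le> X" using pos by simp
    thus "p ^ e p \<le> X" unfolding e_def using bound by (rule GreatestI_nat)
    show "i \<le> e p" if "p ^ i \<le> X" for i
      unfolding e_def using that bound by (rule Greatest_le_nat)
  qed
  have sub: "P3 \<subseteq> {1..s}"
  proof
    fix p assume "p \<in> P3"
    hence "p ^ 2 < (s + 1) ^ 2" "p > 0" using s by (auto simp: P3_def prime_gt_0_nat)
    hence "p < s + 1" using power_less_imp_less_base zero_le by blast
    thus "p \<in> {1..s}" using \<open>p > 0\<close> by simp
  qed
  have fin: "finite P1" "finite P2" "finite P3"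
    using sub finite_subset by (auto simp: P1_def P2_def)
  define C where "C = B * \<Prod>P1 * \<Prod>P2 * (\<Prod>p\<in>P3. p ^ e p)"
  have nz: "0 \<notin> P1" "0 \<notin> P2" "0 \<notin> P3" by (auto simp: P1_def P2_def P3_def)
  have Cpos: "C \<noteq> 0" using pos fin nz by (auto simp: C_def)
  have "A dvd C"
  proof (rule multiplicity_le_imp_dvd)
    fix p :: nat assume p: "prime p"
    have mult_C: "multiplicity p C = multiplicity p B + multiplicity p (\<Prod>P1)
        + multiplicity p (\<Prod>P2) + multiplicity p (\<Prod>p\<in>P3. p ^ e p)"
      unfolding C_def using p pos fin nz
      by (subst prime_elem_multiplicity_mult_distrib; (simp add: prime_imp_prime_elem)?)+
    let ?I = "{i\<in>{1..X}. (X div p ^ i) mod 6 = 1 \<and> (i = 1 \<longrightarrow> G p)}"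
    \<comment> \<open>A quotient that is 1 modulo 6 is nonzero.\<close>
    have I: "p ^ i \<le> X" if "i \<in> ?I" for i
      using that by (metis (mono_tags, lifting) div_less mem_Collect_eq mod_0 not_le zero_neq_one)
    have "card ?I \<le> multiplicity p (\<Prod>P1) + multiplicity p (\<Prod>P2) + multiplicity p (\<Prod>p\<in>P3. p ^ e p)"
    proof (cases "p ^ 2 \<le> X")
      case True
      have "?I \<subseteq> {1..e p}" using e(2)[OF p] I by auto
      hence "card ?I \<le> e p" using card_mono[of "{1..e p}" ?I] by simp
      moreover have "p ^ e p dvd (\<Prod>p\<in>P3. p ^ e p)"
        using True p fin by (intro dvd_prodI) (auto simp: P3_def)
      hence "e p \<le> multiplicity p (\<Prod>p\<in>P3. p ^ e p)"
        using nz fin prime_gt_1_nat[OF p] by (intro multiplicity_geI) auto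
      ultimately show ?thesis by linarith
    next
      case False
      have I1: "?I \<subseteq> {1}"
      proof
        fix i assume i: "i \<in> ?I"
        have "\<not> i \<ge> 2"
        proof
          assume "i \<ge> 2"
          hence "p ^ 2 \<le> p ^ i" using p by (intro power_increasing) (auto simp: prime_gt_0_nat Suc_leI)
          thus False using False I[OF i] by simp
        qed
        thus "i \<in> {1}" using i by auto
      qed
      show ?thesis
      proof (cases "?I = {}")
        case False
        hence "1 \<in> ?I" using I1 by blast
        hence *: "(X div p) mod 6 = 1" "G p" "p \<le> X" using I[of 1] by auto
        have "p \<in> P1 \<union> P2"
        proof (cases "X < 2 * p")
          case False
          hence "2 \<le> X div p" using p prime_gt_0_nat by (simp add: less_eq_div_iff_mult_less_eq)
          moreover have "y \<ge> 7" if "2 \<le> y" "y mod 6 = 1" for y :: nat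
            using that by presburger
          ultimately have "X div p \<ge> 7" using *(1) by blast
          hence "p \<le> X div 7" using p prime_gt_0_nat
            by (simp add: less_eq_div_iff_mult_less_eq mult.commute)
          thus ?thesis using p by (simp add: P2_def)
        qed (use * p in \<open>auto simp: P1_def\<close>)
        hence "p dvd \<Prod>P1 \<or> p dvd \<Prod>P2"
          using fin dvd_prodI[of P1 p "\<lambda>x. x"] dvd_prodI[of P2 p "\<lambda>x. x"] by auto
        moreover have "\<Prod>P1 \<noteq> 0" "\<Prod>P2 \<noteq> 0" using fin nz by auto
        ultimately have "1 \<le> multiplicity p (\<Prod>P1) \<or> 1 \<le> multiplicity p (\<Prod>P2)"
          using p by (simp add: prime_multiplicity_gt_zero_iff Suc_le_eq)
        moreover have "card ?I \<le> 1" using card_mono[OF _ I1] by simp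
        ultimately show ?thesis by linarith
      next
        case True
        show ?thesis unfolding True by simp
      qed
    qed
    thus "multiplicity p A \<le> multiplicity p C"
      using val[OF p] mult_C by linarith
  qed (use pos Cpos in auto)
  hence "A \<le> C" using Cpos by (intro dvd_imp_le) auto
  also have "\<dots> \<le> B * \<Prod>P1 * 4 ^ (X div 7) * X ^ s"
  proof -
    have "\<Prod>P2 \<le> 4 ^ (X div 7)" unfolding P2_def by (rule primorial_le)
    moreover have "(\<Prod>p\<in>P3. p ^ e p) \<le> X ^ s"
    proof -
      have "(\<Prod>p\<in>P3. p ^ e p) \<le> (\<Prod>p\<in>P3. X)"
        using e(1) by (intro prod_mono) (auto simp: P3_def)
      also have "\<dots> = X ^ card P3" by simp
      also have "\<dots> \<le> X ^ s"
        using pos card_mono[OF _ sub] by (intro power_increasing) auto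
      finally show ?thesis .
    qed
    ultimately show ?thesis unfolding C_def by (intro mult_le_mono) auto
  qed
  finally show ?thesis by (simp add: P1_def)
qed

section \<open>Lower bounds for products of primes in an interval\<close>

lemma card_le_Suc:
  "card {c. c \<le> Suc y \<and> P c} = card {c. c \<le> y \<and> P c} + (if P (Suc y) then 1 else 0)"
proof -
  have "{c. c \<le> Suc y \<and> P c} = (if P (Suc y) then insert (Suc y) else id) {c. c \<le> y \<and> P c}"
    by (auto simp: le_Suc_eq)
  thus ?thesis by simp
qed

lemma card_le_mod_3:
  "card {c. c \<le> y \<and> c mod 3 = (1::nat)} = (y + 2) div 3"
  "card {c. c \<le> y \<and> c mod 3 = (2::nat)} = (y + 1) div 3"
  "card {c. c \<le> y \<and> c mod 3 \<noteq> (0::nat)} = y - y div 3"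
proof -
  have "{c. c \<le> (0::nat) \<and> P c} = (if P 0 then {0} else {})" for P by auto
  hence 0: "card {c. c \<le> (0::nat) \<and> P c} = (if P 0 then 1 else 0)" for P by simp
  show "card {c. c \<le> y \<and> c mod 3 = (1::nat)} = (y + 2) div 3"
  proof (induction y)
    case (Suc y)
    have "(Suc y + 2) div 3 = (y + 2) div 3 + (if Suc y mod 3 = 1 then 1 else 0)"
      by presburger
    thus ?case by (simp only: card_le_Suc Suc)
  qed (subst 0, simp)
  show "card {c. c \<le> y \<and> c mod 3 = (2::nat)} = (y + 1) div 3"
  proof (induction y)
    case (Suc y)
    have "(Suc y + 1) div 3 = (y + 1) div 3 + (if Suc y mod 3 = 2 then 1 else 0)"
    proof -
      obtain t r where y: "y = 3 * t + r" "r < 3"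
        by (metis mult_div_mod_eq mod_less_divisor zero_less_numeral)
      from \<open>r < 3\<close> have "r \<in> {0, 1, 2}" by auto
      thus ?thesis unfolding y(1) by (auto simp: mod_Suc) presburger
    qed
    thus ?case by (simp only: card_le_Suc Suc)
  qed (subst 0, simp)
  show "card {c. c \<le> y \<and> c mod 3 \<noteq> (0::nat)} = y - y div 3"
  proof (induction y)
    case (Suc y)
    have "Suc y - Suc y div 3 = y - y div 3 + (if Suc y mod 3 \<noteq> 0 then 1 else 0)"
    proof -
      obtain t r where y: "y = 3 * t + r" "r < 3"
        by (metis mult_div_mod_eq mod_less_divisor zero_less_numeral)
      from \<open>r < 3\<close> have "r \<in> {0, 1, 2}" by auto
      thus ?thesis unfolding y(1) by (auto simp: mod_Suc div_Suc)
    qed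
    thus ?case by (simp only: card_le_Suc Suc)
  qed (subst 0, simp)
qed

lemma card_multiples_le:
  fixes d M :: nat
  assumes "d > 0"
  shows "card {m. m \<le> M \<and> Q m \<and> d dvd m} = card {c. c \<le> M div d \<and> Q (d * c)}"
proof -
  have "{m. m \<le> M \<and> Q m \<and> d dvd m} = (*) d ` {c. c \<le> M div d \<and> Q (d * c)}"
    using assms by (auto simp: less_eq_div_iff_mult_less_eq mult.commute)
  thus ?thesis using assms by (simp add: card_image inj_on_def)
qed

lemma three_dvd_powerD: "(3 :: nat) dvd a ^ i \<Longrightarrow> 3 dvd a"
  by (rule prime_dvd_power) simp

text \<open>Writing \<open>m = d * c\<close> turns the condition on \<open>m\<close> into one on
  \<open>c\<close> modulo 3, with \<open>c <= y = (6 * J) div d\<close>. The first count is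
  \<open>(y + 1) div 3\<close> or \<open>(y + 2) div 3\<close>, according to \<open>d mod 3\<close>,
  against \<open>y div 2 - y div 6\<close>. Only the latter can be larger than this, by one, and
  only for \<open>y mod 6 = 1\<close>.\<close>

lemma card_multiples_mod_3_le:
  fixes d J :: nat
  assumes "d mod 3 \<noteq> 0"
  shows "card {m. m \<le> 6 * J \<and> m mod 3 = 2 \<and> d dvd m} \<le>
         card {m. m \<le> 3 * J \<and> m mod 3 \<noteq> 0 \<and> d dvd m} +
           (if (6 * J) div d mod 6 = 1 \<and> d mod 3 = 2 then 1 else 0)"
proof -
  define y where "y = (6 * J) div d"
  have d: "d > 0" using assms by (auto intro: Nat.gr0I)
  have half: "(3 * J) div d = y div 2"
    by (simp add: y_def mult.commute [of d] flip: div_mult2_eq)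
  have key: "(d * c) mod 3 = (d mod 3) * (c mod 3) mod 3" for c by (simp add: mod_mult_eq)
  have r1: "(d * c) mod 3 = c mod 3" if "d mod 3 = 1" for c
    using key[of c] that by simp
  have r2: "(d * c) mod 3 = 2 \<longleftrightarrow> c mod 3 = 1" "(d * c) mod 3 = 0 \<longleftrightarrow> c mod 3 = 0"
    if "d mod 3 = 2" for c
  proof -
    have "c mod 3 \<in> {0, 1, 2}" by auto
    thus "(d * c) mod 3 = 2 \<longleftrightarrow> c mod 3 = 1" "(d * c) mod 3 = 0 \<longleftrightarrow> c mod 3 = 0"
      using key[of c] that by auto
  qed
  have "d mod 3 = 1 \<or> d mod 3 = 2" using assms by presburger
  hence r0: "(d * c) mod 3 \<noteq> 0 \<longleftrightarrow> c mod 3 \<noteq> 0" for c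
    using r1[of c] r2(2)[of c] by auto
  have B: "card {m. m \<le> 3 * J \<and> m mod 3 \<noteq> 0 \<and> d dvd m} = y div 2 - y div 6"
    by (simp only: card_multiples_le[OF d] r0 half card_le_mod_3)
  from \<open>d mod 3 = 1 \<or> d mod 3 = 2\<close> consider "d mod 3 = 1" | "d mod 3 = 2" by blast
  thus ?thesis
  proof cases
    case 1
    have "card {m. m \<le> 6 * J \<and> m mod 3 = 2 \<and> d dvd m} = (y + 1) div 3"
    proof -
      have "card {m. m \<le> 6 * J \<and> m mod 3 = 2 \<and> d dvd m} = card {c. c \<le> y \<and> (d * c) mod 3 = 2}"
        unfolding y_def by (rule card_multiples_le[OF d])
      also have "{c. c \<le> y \<and> (d * c) mod 3 = 2} = {c. c \<le> y \<and> c mod 3 = 2}"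
        unfolding r1[OF 1] ..
      finally show ?thesis unfolding card_le_mod_3 .
    qed
    moreover have "(y + 1) div 3 + y div 6 \<le> y div 2" by presburger
    ultimately show ?thesis using B by linarith
  next
    case 2
    have "card {m. m \<le> 6 * J \<and> m mod 3 = 2 \<and> d dvd m} = (y + 2) div 3"
    proof -
      have "card {m. m \<le> 6 * J \<and> m mod 3 = 2 \<and> d dvd m} = card {c. c \<le> y \<and> (d * c) mod 3 = 2}"
        unfolding y_def by (rule card_multiples_le[OF d])
      also have "{c. c \<le> y \<and> (d * c) mod 3 = 2} = {c. c \<le> y \<and> c mod 3 = 1}"
        unfolding r2(1)[OF 2] ..
      finally show ?thesis unfolding card_le_mod_3 .
    qed
    moreover have "(y + 2) div 3 + y div 6 \<le> y div 2 + (if y mod 6 = 1 then 1 else 0)"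
    proof -
      obtain t r where y: "y = 6 * t + r" "r < 6"
        by (metis mult_div_mod_eq mod_less_divisor zero_less_numeral)
      from \<open>r < 6\<close> have "r \<in> {0, 1, 2, 3, 4, 5}" by auto
      thus ?thesis unfolding y(1) by auto
    qed
    moreover have "y div 6 \<le> y div 2" by (intro div_le_mono2) auto
    ultimately have "card {m. m \<le> 6 * J \<and> m mod 3 = 2 \<and> d dvd m} \<le>
        card {m. m \<le> 3 * J \<and> m mod 3 \<noteq> 0 \<and> d dvd m} + (if y mod 6 = 1 then 1 else 0)"
      using B by linarith
    thus ?thesis using 2 by (simp only: y_def simp_thms)
  qed
qed

text \<open>Each step of the induction gains at least a factor 4, since
  \<open>6 * J + 2 = 2 * (3 * J + 1)\<close> and
  \<open>6 * J + 5 >= 2 * (3 * J + 2)\<close>.\<close>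

lemma prod_mod_3_quotient_ge:
  "4 ^ J * (\<Prod>{m. m \<le> 3 * J \<and> m mod 3 \<noteq> 0}) \<le> (\<Prod>{m. m \<le> 6 * J \<and> m mod 3 = (2::nat)})"
proof (induction J)
  case (Suc J)
  let ?A = "\<lambda>J. {m. m \<le> 6 * J \<and> m mod 3 = (2::nat)}"
  let ?B = "\<lambda>J. {m. m \<le> 3 * J \<and> m mod 3 \<noteq> (0::nat)}"
  have "x \<le> 6 * Suc J \<and> x mod 3 = 2 \<longleftrightarrow> x = 6 * J + 2 \<or> x = 6 * J + 5 \<or> x \<le> 6 * J \<and> x mod 3 = 2" for x :: nat
    by presburger
  hence A: "?A (Suc J) = insert (6 * J + 2) (insert (6 * J + 5) (?A J))"
    by blast
  have "x \<le> 3 * Suc J \<and> x mod 3 \<noteq> 0 \<longleftrightarrow> x = 3 * J + 1 \<or> x = 3 * J + 2 \<or> x \<le> 3 * J \<and> x mod 3 \<noteq> 0" for x :: nat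
    by presburger
  hence B: "?B (Suc J) = insert (3 * J + 1) (insert (3 * J + 2) (?B J))"
    by blast
  have "4 ^ Suc J * \<Prod>(?B (Suc J)) = 4 * ((3 * J + 1) * (3 * J + 2)) * (4 ^ J * \<Prod>(?B J))"
    unfolding B by (simp add: algebra_simps)
  also have "\<dots> \<le> ((6 * J + 2) * (6 * J + 5)) * \<Prod>(?A J)"
    by (rule mult_le_mono[OF _ Suc.IH]) (simp add: algebra_simps)
  also have "\<dots> = \<Prod>(?A (Suc J))"
    unfolding A by (simp add: algebra_simps)
  finally show ?case .
next
  case 0
  have "{m. m \<le> 3 * 0 \<and> m mod 3 \<noteq> (0::nat)} = {}" "{m. m \<le> 6 * 0 \<and> m mod 3 = (2::nat)} = {}"
    by auto
  thus ?case by (simp only: prod.empty) simp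
qed

text \<open>This is \<open>quotient_le_prod_primes\<close> for the two products of
  \<open>prod_mod_3_quotient_ge\<close>, with \<open>p mod 3 = 2\<close> as the condition
  \<open>G\<close>.\<close>

lemma prod_primes_2_mod_3_ge:
  fixes J s :: nat
  assumes "J > 0" "6 * J < (s + 1)\<^sup>2"
  shows "4 ^ J \<le> (\<Prod>p | prime p \<and> 6 * J < 2 * p \<and> p \<le> 6 * J \<and> p mod 3 = 2. p)
                  * 4 ^ (6 * J div 7) * (6 * J) ^ s"
proof -
  let ?X = "6 * J"
  define SA where "SA = {m. m \<le> 6 * J \<and> m mod 3 = (2::nat)}"
  define SB where "SB = {m. m \<le> 3 * J \<and> m mod 3 \<noteq> (0::nat)}"
  have fin: "finite SA" "finite SB" by (auto simp: SA_def SB_def)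
  have nz: "0 \<notin> SA" "0 \<notin> SB" by (auto simp: SA_def SB_def)
  have pos: "\<Prod>SA > 0" "\<Prod>SB > 0" using fin nz by (auto intro!: Nat.gr0I)
  have "\<Prod>SA \<le> \<Prod>SB * (\<Prod>p | prime p \<and> ?X < 2 * p \<and> p \<le> ?X \<and> p mod 3 = 2. p)
                  * 4 ^ (?X div 7) * ?X ^ s"
  proof (rule quotient_le_prod_primes[OF pos _ assms(2)])
    fix p :: nat assume p: "prime p"
    let ?I = "{i \<in> {1..?X}. ?X div p ^ i mod 6 = 1 \<and> (i = 1 \<longrightarrow> p mod 3 = 2)}"
    have less: "m < p ^ ?X" if "m \<le> ?X" for m
    proof -
      note that
      also have "?X < 2 ^ ?X" by (rule less_exp)
      also have "\<dots> \<le> p ^ ?X" using p prime_ge_2_nat by (intro power_mono) auto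
      finally show ?thesis .
    qed
    \<comment> \<open>For \<open>i > 1\<close> the condition \<open>p ^ i mod 3 = 2\<close> is
      dropped, since \<open>G\<close> restricts only \<open>i = 1\<close>.\<close>
    have card_le: "card {m \<in> SA. p ^ i dvd m} \<le> card {m \<in> SB. p ^ i dvd m} +
                  (if ?X div p ^ i mod 6 = 1 \<and> (i = 1 \<longrightarrow> p mod 3 = 2) then 1 else 0)"
      if "i \<in> {1..?X}" for i
    proof (cases "p = 3")
      case True
      have "m mod 3 = 0" if "p ^ i dvd m" for m
        using that \<open>i \<in> {1..?X}\<close> True by (metis atLeastAtMost_iff dvd_imp_mod_0 dvd_power dvd_trans less_le_trans zero_less_one)
      hence "{m \<in> SA. p ^ i dvd m} = {}" by (auto simp: SA_def)
      thus ?thesis by (simp only: card.empty zero_le)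
    next
      case False
      hence "\<not> 3 dvd p" using primes_dvd_imp_eq[OF _ p, of 3] by auto
      hence "p ^ i mod 3 \<noteq> 0"
        using three_dvd_powerD by (auto simp flip: dvd_eq_mod_eq_0)
      have "{m \<in> SA. p ^ i dvd m} = {m. m \<le> 6 * J \<and> m mod 3 = 2 \<and> p ^ i dvd m}"
        "{m \<in> SB. p ^ i dvd m} = {m. m \<le> 3 * J \<and> m mod 3 \<noteq> 0 \<and> p ^ i dvd m}"
        by (auto simp: SA_def SB_def)
      moreover note card_multiples_mod_3_le[OF \<open>p ^ i mod 3 \<noteq> 0\<close>, of J]
      ultimately show ?thesis by (auto split: if_splits)
    qed
    have "multiplicity p (\<Prod>SA) = (\<Sum>i\<in>{1..?X}. card {m\<in>SA. p ^ i dvd m})"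
      by (intro multiplicity_prod_eq_sum_card p fin nz less) (simp add: SA_def)
    also have "\<dots> \<le> (\<Sum>i\<in>{1..?X}. card {m \<in> SB. p ^ i dvd m} +
                  (if ?X div p ^ i mod 6 = 1 \<and> (i = 1 \<longrightarrow> p mod 3 = 2) then 1 else 0))"
      by (intro sum_mono card_le)
    also have "\<dots> = (\<Sum>i\<in>{1..?X}. card {m \<in> SB. p ^ i dvd m}) + card ?I"
      by (simp add: sum.distrib sum.If_cases Int_def)
    also have "(\<Sum>i\<in>{1..?X}. card {m \<in> SB. p ^ i dvd m}) = multiplicity p (\<Prod>SB)"
      by (intro multiplicity_prod_eq_sum_card [symmetric] p fin nz less) (simp add: SB_def)
    finally show "multiplicity p (\<Prod>SA) \<le> multiplicity p (\<Prod>SB) + card ?I" .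
  qed (use assms in simp)
  moreover have "4 ^ J * \<Prod>SB \<le> \<Prod>SA"
    unfolding SA_def SB_def by (rule prod_mod_3_quotient_ge)
  ultimately have "\<Prod>SB * 4 ^ J \<le> \<Prod>SB * ((\<Prod>p | prime p \<and> ?X < 2 * p \<and> p \<le> ?X \<and> p mod 3 = 2. p)
                  * 4 ^ (?X div 7) * ?X ^ s)"
    by (simp only: mult.assoc mult.commute[of "4 ^ J"])
  thus ?thesis using pos by simp
qed

text \<open>With \<open>y = (6 * a) div d\<close>, Legendre's formula leads to
  \<open>y + 2 * (y div 6) - 2 * (y div 2) - y div 3\<close>, which depends only on
  \<open>y mod 6\<close>: it is 1 for residue 1 and never positive otherwise. As for size,
  \<open>(6 * a) choose (3 * a)\<close> is at least \<open>64 ^ a / (6 * a)\<close> and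
  \<open>(2 * a) choose a\<close> at most \<open>4 ^ a\<close>.\<close>

lemma prod_primes_ge:
  fixes a s :: nat
  assumes "a > 0" "6 * a < (s + 1)\<^sup>2"
  shows "16 ^ a \<le> 6 * a * (\<Prod>p | prime p \<and> 6 * a < 2 * p \<and> p \<le> 6 * a. p)
                  * 4 ^ (6 * a div 7) * (6 * a) ^ s"
proof -
  let ?X = "6 * a"
  let ?P = "\<Prod>p | prime p \<and> ?X < 2 * p \<and> p \<le> ?X. p"
  define A where "A = (fact (6 * a) * fact a * fact a :: nat)"
  define B where "B = (fact (3 * a) * fact (3 * a) * fact (2 * a) :: nat)"
  have pos: "A > 0" "B > 0" by (simp_all add: A_def B_def)
  have "A \<le> B * (\<Prod>p | prime p \<and> ?X < 2 * p \<and> p \<le> ?X \<and> True. p) * 4 ^ (?X div 7) * ?X ^ s"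
  proof (rule quotient_le_prod_primes[OF pos _ assms(2)])
    fix p :: nat assume p: "prime p"
    let ?I = "{i \<in> {1..?X}. ?X div p ^ i mod 6 = 1 \<and> (i = 1 \<longrightarrow> True)}"
    have div_le: "?X div d + a div d + a div d \<le>
        3 * a div d + 3 * a div d + 2 * a div d + (if ?X div d mod 6 = 1 then 1 else 0)" for d
    proof -
      define y where "y = ?X div d"
      have "3 * a div d = y div 2" "2 * a div d = y div 3" "a div d = y div 6"
        unfolding y_def by (simp_all add: mult.commute[of d] flip: div_mult2_eq)
      moreover have "y + y div 6 + y div 6 \<le> y div 2 + y div 2 + y div 3 + (if y mod 6 = 1 then 1 else 0)"
        by presburger
      ultimately show ?thesis by (simp add: y_def)
    qed
    have "multiplicity p A = (\<Sum>i\<in>{1..?X}. ?X div p ^ i + a div p ^ i + a div p ^ i)"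
      unfolding A_def using p multiplicity_fact_eq_sum[OF p, of ?X ?X] multiplicity_fact_eq_sum[OF p, of a ?X]
      by (simp add: prime_elem_multiplicity_mult_distrib sum.distrib)
    also have "\<dots> \<le> (\<Sum>i\<in>{1..?X}. 3 * a div p ^ i + 3 * a div p ^ i + 2 * a div p ^ i + (if ?X div p ^ i mod 6 = 1 then 1 else 0))"
      by (intro sum_mono div_le)
    also have "\<dots> = multiplicity p B + card ?I"
      unfolding B_def using p multiplicity_fact_eq_sum[OF p, of "3 * a" ?X] multiplicity_fact_eq_sum[OF p, of "2 * a" ?X]
      by (simp add: prime_elem_multiplicity_mult_distrib sum.distrib sum.If_cases Int_def)
    finally show "multiplicity p A \<le> multiplicity p B + card ?I" .
  qed (use assms in simp)
  hence 1: "A \<le> B * (?P * 4 ^ (?X div 7) * ?X ^ s)" by (simp add: mult_ac)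
  have 2: "B * 16 ^ a \<le> 6 * a * A"
  proof -
    have f: "fact (6 * a) = fact (3 * a) * fact (3 * a) * ((6 * a) choose (3 * a))"
      "fact (2 * a) = fact a * fact a * ((2 * a) choose a)"
      using binomial_fact_lemma[of "3 * a" "6 * a"] binomial_fact_lemma[of a "2 * a"] by simp_all
    have "real (4 ^ (3 * a)) \<le> real (6 * a * ((6 * a) choose (3 * a)))"
      using central_binomial_lower_bound[of "3 * a"] assms by (simp add: field_simps)
    hence "64 ^ a \<le> 6 * a * ((6 * a) choose (3 * a))"
      by (subst (asm) of_nat_le_iff) (simp add: power_mult)
    moreover have "(2 * a) choose a \<le> 4 ^ a"
      using binomial_le_pow2[of "2 * a" a] by (simp add: power_mult)
    moreover have "(4 :: nat) ^ a * 16 ^ a = 64 ^ a"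
      by (simp flip: power_mult_distrib)
    ultimately have "((2 * a) choose a) * 16 ^ a \<le> 6 * a * ((6 * a) choose (3 * a))"
      by (metis mult_le_mono1 order_trans)
    hence "fact (3 * a) * fact (3 * a) * (fact a * fact a) * (((2 * a) choose a) * 16 ^ a)
         \<le> fact (3 * a) * fact (3 * a) * (fact a * fact a) * (6 * a * ((6 * a) choose (3 * a)))"
      by (rule mult_le_mono2)
    thus ?thesis unfolding A_def B_def f by (simp only: mult_ac)
  qed
  have "B * 16 ^ a \<le> 6 * a * (B * (?P * 4 ^ (?X div 7) * ?X ^ s))"
    using 2 1 by (meson mult_le_mono2 order_trans)
  hence "B * 16 ^ a \<le> B * (6 * a * ?P * 4 ^ (?X div 7) * ?X ^ s)"
    by (simp only: mult_ac)
  thus ?thesis using pos by simp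
qed

section \<open>An upper bound for primes that are 1 modulo a prime\<close>

lemma multiplicity_fact_le:
  fixes p n :: nat
  assumes "prime p"
  shows "(p - 1) * multiplicity p (fact n) \<le> n"
proof -
  \<comment> \<open>The tail \<open>n div p ^ N\<close> makes the bound inductive: the next summand,
    weighted by \<open>p - 1\<close>, and the new tail add up to
    \<open>p * (n div p ^ Suc N)\<close>, at most the old tail.\<close>
  have "(p - 1) * (\<Sum>i\<in>{1..N}. n div p ^ i) + n div p ^ N \<le> n" for N
  proof (induction N)
    case (Suc N)
    obtain q where q: "p = Suc q" using prime_gt_0_nat[OF assms] by (cases p) auto
    have "(p - 1) * (\<Sum>i\<in>{1..Suc N}. n div p ^ i) + n div p ^ Suc N
        = (p - 1) * (\<Sum>i\<in>{1..N}. n div p ^ i) + p * (n div p ^ Suc N)"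
      unfolding q by (simp add: algebra_simps)
    also have "p * (n div p ^ Suc N) \<le> n div p ^ N"
      by (simp add: div_mult2_eq mult.commute[of p])
    finally show ?case using Suc by simp
  qed simp
  from this[of n] show ?thesis
    using multiplicity_fact_eq_sum[OF assms, of n n] by simp
qed

text \<open>Multiplied by \<open>fact m\<close>, the product becomes \<open>fact (m + h)\<close>, a
  multiple of \<open>fact h * fact m\<close>.\<close>

lemma fact_dvd_prod_consecutive: "fact h dvd (\<Prod>j\<in>{1..h}. m + j :: nat)"
proof -
  have "(\<Prod>j\<in>{1..h}. m + j) * fact m = fact (m + h)"
  proof (induction h)
    case (Suc h)
    have "(\<Prod>j\<in>{1..Suc h}. m + j) * fact m = (m + Suc h) * ((\<Prod>j\<in>{1..h}. m + j) * fact m)"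
      by (simp only: prod.nat_ivl_Suc' mult_ac)
    thus ?case by (simp only: Suc) simp
  qed simp
  moreover have "fact h * fact m dvd (fact (h + m) :: nat)"
    by (rule fact_fact_dvd_fact)
  ultimately have "fact h * fact m dvd (\<Prod>j\<in>{1..h}. m + j) * fact m"
    by (simp add: add.commute)
  thus ?thesis by (simp only: dvd_times_right_cancel_iff fact_nonzero not_False_eq_True)
qed

lemma prime_power_dvd_prod_AP:
  fixes p d a h v :: nat
  assumes "coprime p d" "p ^ v dvd fact h"
  shows "p ^ v dvd (\<Prod>j\<in>{1..h}. d * (a + j) + 1)"
proof -
  \<comment> \<open>Multiplying by the inverse \<open>u\<close> of \<open>d\<close> turns the progression into consecutive integers.\<close>
  obtain u where u: "[d * u = 1] (mod p ^ v)"
    using assms(1) cong_solve_coprime_nat[of d "p ^ v"]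
    by (auto simp: coprime_commute)
  have "[(\<Prod>j\<in>{1..h}. d * (a + j) + 1) * u ^ h = (\<Prod>j\<in>{1..h}. (a + u) + j)] (mod p ^ v)"
  proof -
    have "(\<Prod>j\<in>{1..h}. d * (a + j) + 1) * u ^ h = (\<Prod>j\<in>{1..h}. (d * (a + j) + 1) * u)"
      by (subst prod.distrib) simp
    also have "[\<dots> = (\<Prod>j\<in>{1..h}. (a + u) + j)] (mod p ^ v)"
    proof (rule cong_prod)
      fix j
      have "[d * u * (a + j) + u = 1 * (a + j) + u] (mod p ^ v)"
        using u by (intro cong_add cong_mult cong_refl)
      thus "[(d * (a + j) + 1) * u = (a + u) + j] (mod p ^ v)"
        by (simp add: algebra_simps)
    qed
    finally show ?thesis .
  qed
  moreover have "p ^ v dvd (\<Prod>j\<in>{1..h}. (a + u) + j)"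
    using assms(2) fact_dvd_prod_consecutive dvd_trans by blast
  ultimately have "p ^ v dvd (\<Prod>j\<in>{1..h}. d * (a + j) + 1) * u ^ h"
    by (simp add: cong_dvd_iff)
  moreover have "coprime (p ^ v) u"
    using cong_imp_coprime[OF cong_sym[OF u]] by (auto simp: coprime_commute)
  ultimately show ?thesis
    by (simp add: coprime_dvd_mult_left_iff)
qed

text \<open>Primes not dividing \<open>2 * k\<close> are handled by the progression itself. The
  powers of 2 and \<open>k\<close> in front cover the other two, whose multiplicities in
  \<open>fact h\<close> are at most \<open>h\<close> and \<open>h div (k - 1)\<close>.\<close>

lemma fact_dvd_prod_AP:
  fixes k a h :: nat
  assumes k: "prime k" "odd k"
  shows "fact h dvd 2 ^ h * k ^ (h div (k - 1)) * (\<Prod>j\<in>{1..h}. 2 * k * (a + j) + 1)"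
    (is "_ dvd ?R")
proof (rule multiplicity_le_imp_dvd)
  have pos: "?R \<noteq> 0" using k by (auto simp: prime_gt_0_nat)
  fix p :: nat assume p: "prime p"
  show "multiplicity p (fact h) \<le> multiplicity p ?R"
  proof (rule multiplicity_geI)
    show "\<not> is_unit p" "?R \<noteq> 0" using p pos by auto
    consider "p = 2" | "p = k" | "p \<noteq> 2" "p \<noteq> k" by blast
    thus "p ^ multiplicity p (fact h) dvd ?R"
    proof cases
      case 1
      hence "multiplicity p (fact h) \<le> h" using multiplicity_fact_le[OF p, of h] by simp
      thus ?thesis using 1 by (auto intro!: dvd_mult2 le_imp_power_dvd)
    next
      case 2
      have "k - 1 > 0" using prime_gt_1_nat[OF k(1)] by simp
      hence "multiplicity p (fact h) \<le> h div (k - 1)"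
        using multiplicity_fact_le[OF p, of h] 2
        by (simp add: less_eq_div_iff_mult_less_eq mult.commute)
      hence "p ^ multiplicity p (fact h) dvd k ^ (h div (k - 1))"
        using 2 by (simp add: le_imp_power_dvd)
      thus ?thesis by (intro dvd_mult2[OF dvd_mult])
    next
      case 3
      have "coprime p (2 * k)"
        using 3 p k primes_coprime[of p k] primes_coprime[of p 2] by simp
      thus ?thesis
        by (intro dvd_mult prime_power_dvd_prod_AP multiplicity_dvd)
    qed
  qed
qed auto

text \<open>A single term of the exponential series is at most \<open>exp x\<close>. With
  \<open>x\<close> left free it can be the expected number of terms instead of
  \<open>h\<close>.\<close>

lemma ln_fact_ge:
  assumes "(x::real) > 0"
  shows "real h * ln x - x \<le> ln (fact h)"
proof -
  have "x ^ h / fact h \<le> exp x"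
  proof -
    have "(\<Sum>n\<in>{h}. inverse (fact n) * x ^ n) \<le> (\<Sum>n. inverse (fact n) * x ^ n)"
      using assms summable_exp[of x] by (intro sum_le_suminf) auto
    thus ?thesis by (simp add: exp_def scaleR_conv_of_real field_simps)
  qed
  hence "ln (x ^ h / fact h) \<le> ln (exp x)"
    using assms by (subst ln_le_cancel_iff) auto
  thus ?thesis using assms by (simp add: ln_div ln_realpow)
qed

text \<open>The primes in \<open>P\<close> are terms of the progression \<open>2 * k * j + 1\<close>
  and exceed its number \<open>h\<close> of terms in range. So \<open>\<Prod>P\<close> is coprime to
  \<open>fact h\<close>, and \<open>fact_dvd_prod_AP\<close> allows division by
  \<open>fact h\<close>.\<close>

lemma prod_primes_1_mod_le:
  fixes a k :: nat
  assumes k: "prime k" "odd k" "k \<le> 3 * a"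
  defines "H \<equiv> 3 * real a / (2 * real k)"
  defines "P \<equiv> {p. prime p \<and> 6 * a < 2 * p \<and> p \<le> 6 * a \<and> k dvd p - 1}"
  shows "ln (real (\<Prod>P)) \<le> (H + 1) * (ln (6 * real k) + ln (real k) / (real k - 1)) + H + 1"
proof -
  have k3: "k \<ge> 3" using k prime_ge_2_nat[OF k(1)] by (cases "k = 2") auto
  have a: "a > 0" using k k3 by (cases a) auto
  \<comment> \<open>\<open>lo\<close> and \<open>hi\<close> are the last indices \<open>j\<close>
    for which \<open>2 * k * j + 1\<close> is at most \<open>3 * a\<close> and \<open>6 * a\<close>,
    respectively.\<close>
  define lo where "lo = (3 * a - 1) div (2 * k)"
  define hi where "hi = (6 * a - 1) div (2 * k)"
  define h where "h = hi - lo"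
  have "lo \<le> hi" unfolding lo_def hi_def by (intro div_le_mono) simp
  hence hi: "hi = lo + h" by (simp add: h_def)
  have lo1: "2 * k * lo + 1 \<le> 3 * a"
  proof -
    have "2 * k * lo \<le> 3 * a - 1" unfolding lo_def by (rule times_div_less_eq_dividend)
    thus ?thesis using a by simp
  qed
  have lo2: "3 * a \<le> 2 * k * (lo + 1)"
  proof -
    have "3 * a - 1 < 2 * k * (lo + 1)"
      unfolding lo_def using k3 dividend_less_times_div[of "2 * k" "3 * a - 1"] by simp
    thus ?thesis by simp
  qed
  have hi1: "2 * k * (lo + h) + 1 \<le> 6 * a"
  proof -
    have "2 * k * hi \<le> 6 * a - 1" unfolding hi_def by (rule times_div_less_eq_dividend)
    thus ?thesis using a hi by simp
  qed
  let ?AP = "\<Prod>j\<in>{1..h}. 2 * k * (lo + j) + 1"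
  have finP: "finite P" by (simp add: P_def)
  have P_AP: "\<exists>j\<in>{1..h}. p = 2 * k * (lo + j) + 1" if "p \<in> P" for p
  proof -
    have p: "prime p" "3 * a < p" "p \<le> 6 * a" "k dvd p - 1" using that by (auto simp: P_def)
    have "odd p" using p a primes_dvd_imp_eq[of 2 p] by auto
    hence "2 dvd p - 1" by simp
    moreover have "coprime 2 k" using k by simp
    ultimately have "2 * k dvd p - 1" using p(4) by (intro divides_mult)
    then obtain c where c: "p - 1 = 2 * k * c" by (elim dvdE)
    hence pc: "p = 2 * k * c + 1" using p by simp
    have "2 * k * c \<ge> 3 * a" using p pc by simp
    have "lo < c"
    proof (rule ccontr)
      assume "\<not> lo < c"
      hence "2 * k * c \<le> 2 * k * lo" by (intro mult_le_mono2) simp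
      thus False using lo1 \<open>2 * k * c \<ge> 3 * a\<close> by linarith
    qed
    moreover have "c \<le> hi"
    proof -
      have "c * (2 * k) \<le> 6 * a - 1" using p pc by (simp add: mult_ac)
      thus ?thesis unfolding hi_def using k3 by (simp add: less_eq_div_iff_mult_less_eq)
    qed
    ultimately have "c - lo \<in> {1..h}" "p = 2 * k * (lo + (c - lo)) + 1"
      using hi pc by auto
    thus ?thesis by blast
  qed
  have "\<Prod>P dvd ?AP"
  proof (rule prod_primes_dvd[OF finP])
    fix p assume "p \<in> P"
    then obtain j where "j \<in> {1..h}" "p = 2 * k * (lo + j) + 1" using P_AP by blast
    thus "p dvd ?AP" using dvd_prodI[of "{1..h}" j "\<lambda>j. 2 * k * (lo + j) + 1"] by simp
  qed (simp add: P_def)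
  hence "\<Prod>P dvd 2 ^ h * k ^ (h div (k - 1)) * ?AP" by (rule dvd_mult)
  moreover have "coprime (fact h) (\<Prod>P)"
  proof (rule prod_coprime_right)
    fix p assume "p \<in> P"
    hence p: "prime p" "3 * a < p" by (auto simp: P_def)
    \<comment> \<open>As \<open>2 * k >= 6\<close>, this gives \<open>h < a\<close>.\<close>
    have "6 * h \<le> 2 * k * (lo + h)" using k3 by (intro mult_le_mono) auto
    hence "h < p" using hi1 p(2) by linarith
    hence "\<not> p dvd fact h" using p by (simp add: prime_dvd_fact_iff)
    thus "coprime (fact h) p" using p by (simp add: prime_imp_coprime coprime_commute)
  qed
  ultimately have "fact h * \<Prod>P dvd 2 ^ h * k ^ (h div (k - 1)) * ?AP"
    using fact_dvd_prod_AP[OF k(1,2)] by (intro divides_mult)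
  moreover have AP_pos: "?AP > 0" by simp
  ultimately have le: "fact h * \<Prod>P \<le> 2 ^ h * k ^ (h div (k - 1)) * ?AP"
    using k3 by (intro dvd_imp_le) simp_all
  define Q where "Q = \<Prod>P"
  define R where "R = ?AP"
  have pos: "Q > 0" "R > 0" unfolding Q_def R_def by (auto intro!: prod_pos simp: P_def prime_gt_0_nat)
  have le: "fact h * Q \<le> 2 ^ h * k ^ (h div (k - 1)) * R" using le unfolding Q_def R_def .
  \<comment> \<open>\<open>M\<close> is the midpoint of \<open>{3 * a..6 * a}\<close>, where the logarithm is replaced by its tangent, and
    \<open>H\<close> is the expected number of terms.\<close>
  define M where "M = 9 * real a / 2"
  have HM: "H > 0" "M > 0" "M = 3 * real k * H" using a k3 by (auto simp: H_def M_def)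
  have "ln (fact h) + ln (real Q) = ln (real (fact h * Q))"
    using pos by (simp add: ln_mult)
  also have "\<dots> \<le> ln (real (2 ^ h * k ^ (h div (k - 1)) * R))"
    by (rule ln_mono) (use le pos in \<open>simp_all only: of_nat_le_iff of_nat_0_less_iff\<close>, simp)
  also have "\<dots> = real h * ln 2 + real (h div (k - 1)) * ln (real k) + ln (real R)"
    using k3 pos by (simp add: ln_mult ln_realpow)
  also have "ln (real R) = (\<Sum>j\<in>{1..h}. ln (real (2 * k * (lo + j) + 1)))"
    unfolding R_def of_nat_prod by (rule ln_prod) (simp_all del: of_nat_add of_nat_mult of_nat_Suc)
  also have "\<dots> \<le> (\<Sum>j\<in>{1..h}. ln M + real (2 * k * (lo + j) + 1) / M - 1)"
  proof (rule sum_mono)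
    fix j
    define x where "x = real (2 * k * (lo + j) + 1)"
    have "x > 0" by (simp add: x_def add_pos_nonneg)
    hence "ln x - ln M \<le> x / M - 1"
      using HM(2) ln_le_minus_one[of "x / M"] by (simp add: ln_div)
    thus "ln (real (2 * k * (lo + j) + 1)) \<le> ln M + real (2 * k * (lo + j) + 1) / M - 1"
      by (simp add: x_def)
  qed
  also have "\<dots> = real h * (ln M - 1) + (\<Sum>j\<in>{1..h}. real (2 * k * (lo + j) + 1)) / M"
    by (simp only: sum.distrib sum_subtractf flip: sum_divide_distrib) (simp add: algebra_simps)
  \<comment> \<open>The terms of indices \<open>lo\<close> and \<open>lo + h\<close> have mean at
    most \<open>M\<close>; starting at \<open>lo + 1\<close> raises the mean by
    \<open>k\<close>.\<close>
  also have "(\<Sum>j\<in>{1..h}. real (2 * k * (lo + j) + 1)) \<le> real h * (M + real k)"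
  proof -
    have "(\<Sum>j\<in>{1..n}. real (2 * k * (lo + j) + 1))
        = real n * (real k * (2 * real lo + real n) + 1 + real k)" for n
      by (induction n) (simp_all add: algebra_simps)
    moreover have "real k * (2 * real lo + real h) + 1 \<le> M"
    proof -
      have "real (2 * k * lo + 1) + real (2 * k * (lo + h) + 1) \<le> 9 * real a"
        using lo1 hi1 by linarith
      thus ?thesis by (simp add: M_def algebra_simps)
    qed
    ultimately show ?thesis by (simp add: mult_left_mono)
  qed
  finally have "ln (fact h) + ln (real Q) \<le> real h * ln 2 + real (h div (k - 1)) * ln (real k)
      + (real h * (ln M - 1) + real h * (M + real k) / M)"
    using HM(2) by (simp add: divide_right_mono)
  moreover have "real h * (M + real k) / M = real h + real h * real k / M"
    using HM(2) by (simp add: field_simps)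
  moreover have "real h * ln H - H \<le> ln (fact h)" using HM by (intro ln_fact_ge)
  \<comment> \<open>The terms \<open>h * ln M\<close> and \<open>h * ln H\<close> now cancel up to
    \<open>h * ln (3 * k)\<close>, which removes \<open>a\<close> from the main factor.\<close>
  moreover have "ln M = ln (3 * real k) + ln H"
    unfolding HM(3) by (rule ln_mult_pos) (use HM(1) k3 in auto)
  moreover have "ln (6 * real k) = ln 2 + ln (3 * real k)"
    using k3 ln_mult_pos[of 2 "3 * real k"] by simp
  moreover have "real (h div (k - 1)) * ln (real k) \<le> real h * (ln (real k) / (real k - 1))"
  proof -
    have "real (h div (k - 1)) \<le> real h / real (k - 1)" by (rule of_nat_div_le_of_nat)
    hence "real (h div (k - 1)) * ln (real k) \<le> real h / real (k - 1) * ln (real k)"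
      using k3 by (intro mult_right_mono) auto
    thus ?thesis using k3 by (simp add: of_nat_diff)
  qed
  ultimately have "ln (real Q) \<le> real h * (ln (6 * real k) + ln (real k) / (real k - 1))
      + H + real h * real k / M"
    by (simp add: algebra_simps)
  moreover have hH: "real h \<le> H + 1"
  proof -
    have "2 * k * h \<le> 3 * a + 2 * k" using lo2 hi1 by (simp add: algebra_simps)
    hence "real (2 * k * h) \<le> real (3 * a + 2 * k)" by (simp only: of_nat_le_iff)
    thus ?thesis using k3 by (simp add: H_def field_simps)
  qed
  moreover have "real h * real k / M \<le> 1"
  proof -
    have "real h * real k \<le> (H + 1) * real k" using hH by (intro mult_right_mono) auto
    also have "\<dots> = 3 * real a / 2 + real k" using k3 by (simp add: H_def field_simps)
    also have "\<dots> \<le> M"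
    proof -
      have "real k \<le> real (3 * a)" using k by (simp only: of_nat_le_iff)
      thus ?thesis by (simp add: M_def)
    qed
    finally show ?thesis using HM(2) by simp
  qed
  moreover have "real h * (ln (6 * real k) + ln (real k) / (real k - 1))
      \<le> (H + 1) * (ln (6 * real k) + ln (real k) / (real k - 1))"
    using hH k3 by (intro mult_right_mono add_nonneg_nonneg divide_nonneg_nonneg) auto
  ultimately show ?thesis unfolding Q_def by linarith
qed

section \<open>Primes that are not 1 modulo a given prime\<close>

lemma ln_2_ge: "ln (2 :: real) \<ge> 693 / 1000"
  using ln_approx_bounds[of 2 3] by (simp add: eval_nat_numeral)

lemma ln_4: "ln (4 :: real) = 2 * ln 2"
  using ln_realpow[of 2 2] by simp

lemma ln_16: "ln (16 :: real) = 4 * ln 2"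
  using ln_realpow[of 2 4] by simp

text \<open>Replacing \<open>ln\<close> by its tangent at 5 leaves a bound decreasing in
  \<open>k\<close>, so \<open>k = 5\<close> is the worst case:
  \<open>573 / 500 + 3 / 10 = 1446 / 1000\<close>.\<close>

lemma prod_primes_1_mod_le_linear:
  fixes a k :: nat
  assumes k: "prime k" "k \<ge> 5" "k \<le> 3 * a"
  shows "ln (real (\<Prod>p | prime p \<and> 6 * a < 2 * p \<and> p \<le> 6 * a \<and> k dvd p - 1. p))
           \<le> 1446 / 1000 * real a + ln (18 * real a) + 141 / 100"
proof -
  define H where "H = 3 * real a / (2 * real k)"
  define u where "u = ln (6 * real k)"
  define v where "v = ln (real k) / (real k - 1)"
  have "odd k" using k prime_odd_nat[of k] by simp
  have tangent: "ln (real k) \<le> ln 5 + (real k / 5 - 1)"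
    using k ln_le_minus_one[of "real k / 5"] by (simp add: ln_div)
  \<comment> \<open>Comparing 30 with 32, and 5 with 4, reduces both logarithms to
    \<open>ln 2\<close>.\<close>
  have "ln (30 :: real) = 5 * ln 2 + ln (15 / 16)"
    using ln_mult_pos[of 32 "15 / 16 :: real"] ln_realpow[of 2 5] by simp
  hence ln_30: "ln (30 :: real) \<le> 341 / 100"
    using ln2_le_25_over_36 ln_le_minus_one[of "15 / 16 :: real"] by simp
  have "ln (5 :: real) = 2 * ln 2 + ln (5 / 4)"
    using ln_mult_pos[of 4 "5 / 4 :: real"] ln_4 by simp
  hence ln_5: "ln (5 :: real) \<le> 1639 / 1000"
    using ln2_le_25_over_36 ln_le_minus_one[of "5 / 4 :: real"] by simp
  have "ln (6 * 5 :: real) = ln 6 + ln 5" by (rule ln_mult_pos) auto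
  hence "u \<le> ln 30 + (real k / 5 - 1)"
    using tangent k ln_mult_pos[of 6 "real k"] by (simp add: u_def)
  hence u: "u \<le> 241 / 100 + real k / 5" using ln_30 by simp
  have "ln (real k) \<le> 41 / 100 * (real k - 1)" using tangent ln_5 k by simp
  hence v: "v \<le> 41 / 100" using k by (simp add: v_def pos_divide_le_eq)
  have u': "u \<le> ln (18 * real a)" unfolding u_def using k by (intro ln_mono) auto
  have "H \<ge> 0" using k by (simp add: H_def)
  hence "H * (u + v + 1) \<le> H * (382 / 100 + real k / 5)"
    using u v by (intro mult_left_mono) auto
  also have "\<dots> = real a * (573 / 100 / real k + 3 / 10)"
    using k by (simp add: H_def field_simps)
  also have "\<dots> \<le> real a * (1446 / 1000)"
    using k by (intro mult_left_mono) (auto simp: field_simps)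
  finally have "H * (u + v + 1) \<le> 1446 / 1000 * real a" by simp
  moreover have "ln (real (\<Prod>p | prime p \<and> 6 * a < 2 * p \<and> p \<le> 6 * a \<and> k dvd p - 1. p))
      \<le> (H + 1) * (u + v) + H + 1"
    unfolding H_def u_def v_def using k \<open>odd k\<close> by (intro prod_primes_1_mod_le)
  ultimately show ?thesis using u' v by (simp add: algebra_simps)
qed

lemma exists_floor_sqrt: "\<exists>s. X < (s + 1)\<^sup>2 \<and> real s \<le> sqrt (real X)"
proof -
  define s where "s = nat \<lfloor>sqrt (real X)\<rfloor>"
  have "real s \<le> sqrt (real X)" "sqrt (real X) < real (s + 1)"
    unfolding s_def by (simp_all, linarith)
  moreover from this(2) have "sqrt (real X) ^ 2 < real (s + 1) ^ 2"
    by (intro power_strict_mono) auto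
  hence "real X < real ((s + 1)\<^sup>2)" by simp
  ultimately show ?thesis unfolding of_nat_less_iff by blast
qed

text \<open>This absorbs the error terms for large \<open>X\<close>: the factor
  \<open>X ^ s\<close>, at most five further factors \<open>X\<close>, and an additive constant 3.
  The logarithm of \<open>sqrt X\<close> is bounded by its tangent at 1000.\<close>

lemma sqrt_mult_ln_le:
  assumes X: "X \<ge> (10 :: real) ^ 6" and s: "s \<le> sqrt X"
  shows "(s + 5) * ln X + 3 \<le> 2 / 100 * X"
proof -
  define t where "t = sqrt X"
  have "t \<ge> 1000" unfolding t_def using X by (intro real_le_rsqrt) simp
  have Xt: "X = t * t" using X by (simp add: t_def)
  \<comment> \<open>1000 is close to \<open>1024 = 2 ^ 10\<close>.\<close>
  have "ln (1000 :: real) \<le> ln 1024" by (intro ln_mono) auto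
  also have "\<dots> = 10 * ln 2" using ln_realpow[of 2 10] by simp
  finally have ln_1000: "ln (1000 :: real) \<le> 6945 / 1000" using ln2_le_25_over_36 by simp
  have "ln t = ln (1000 * (t / 1000))" by simp
  also have "\<dots> = ln 1000 + ln (t / 1000)" using \<open>t \<ge> 1000\<close> by (intro ln_mult_pos) auto
  also have "ln (t / 1000) \<le> t / 1000 - 1" using \<open>t \<ge> 1000\<close> by (intro ln_le_minus_one) auto
  finally have "ln t \<le> 5945 / 1000 + t / 1000" using ln_1000 by simp
  moreover have "ln X = 2 * ln t" unfolding Xt using \<open>t \<ge> 1000\<close> by (subst ln_mult_pos) auto
  ultimately have lnX: "ln X \<le> 1189 / 100 + t / 500" by simp
  have "(s + 5) * ln X \<le> (t + 5) * ln X"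
    using s X by (intro mult_right_mono) (auto simp: t_def)
  also have "\<dots> \<le> (t + 5) * (1189 / 100 + t / 500)"
    using lnX \<open>t \<ge> 1000\<close> by (intro mult_left_mono) auto
  also have "\<dots> \<le> 2 / 100 * X - 3"
  proof -
    have "t * 1000 \<le> t * t" using \<open>t \<ge> 1000\<close> by (intro mult_left_mono) auto
    moreover have "(t + 5) * (1189 / 100 + t / 500) = t * t / 500 + 119 / 10 * t + 5945 / 100"
      by (simp add: field_simps)
    ultimately show ?thesis unfolding Xt using \<open>t \<ge> 1000\<close> by linarith
  qed
  finally show ?thesis by simp
qed

lemma prod_le_power_card:
  fixes P :: "nat set"
  assumes "P \<subseteq> S" "finite S" "card S \<le> c" "\<And>p. p \<in> P \<Longrightarrow> p \<le> X" "X > 0"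
  shows "\<Prod>P \<le> X ^ c"
proof -
  have "\<Prod>P \<le> (\<Prod>p\<in>P. X)" using assms by (intro prod_mono) auto
  also have "\<dots> = X ^ card P" by simp
  also have "\<dots> \<le> X ^ c"
    using assms card_mono[of S P] by (intro power_increasing) auto
  finally show ?thesis .
qed

section \<open>Primes in \<open>{n<..2 * n}\<close> for large \<open>n\<close>\<close>

text \<open>Without such a prime, the product bounded from below in
  \<open>prod_primes_2_mod_3_ge\<close> has at most two factors, caused by rounding \<open>n\<close>
  down to \<open>3 * a\<close>.\<close>

lemma exists_prime_2_mod_3:
  fixes n :: nat
  assumes n: "n \<ge> 500001"
  shows "\<exists>p. prime p \<and> n < p \<and> p \<le> 2 * n \<and> p mod 3 = 2"
proof (rule ccontr)
  assume none: "\<not> ?thesis"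
  define a where "a = n div 3"
  define X where "X = 6 * a"
  define P where "P = {p. prime p \<and> X < 2 * p \<and> p \<le> X \<and> p mod 3 = 2}"
  have a: "a \<ge> 166667" "3 * a \<le> n" "n \<le> 3 * a + 2" using n by (auto simp: a_def)
  have X: "real X \<ge> 10 ^ 6" using a by (simp add: X_def)
  obtain s where s: "X < (s + 1)\<^sup>2" "real s \<le> sqrt (real X)"
    using exists_floor_sqrt by blast
  have "P \<subseteq> {3 * a + 1, 3 * a + 2}"
  proof
    fix p assume p: "p \<in> P"
    hence "prime p" "p \<le> 2 * n" "p mod 3 = 2" "3 * a < p" using a by (auto simp: P_def X_def)
    hence "p \<le> n" using none not_le by blast
    thus "p \<in> {3 * a + 1, 3 * a + 2}" using \<open>3 * a < p\<close> a by simp linarith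
  qed
  hence "\<Prod>P \<le> X ^ 2" by (rule prod_le_power_card) (use a in \<open>auto simp: P_def X_def\<close>)
  have "4 ^ a \<le> \<Prod>P * 4 ^ (X div 7) * X ^ s"
    using prod_primes_2_mod_3_ge[of a s] a s unfolding P_def X_def by simp
  also have "\<dots> \<le> X ^ 2 * 4 ^ (X div 7) * X ^ s"
    using \<open>\<Prod>P \<le> X ^ 2\<close> by (intro mult_le_mono) auto
  finally have "ln (real (4 ^ a)) \<le> ln (real (X ^ 2 * 4 ^ (X div 7) * X ^ s))"
    by (intro ln_mono) (simp_all only: of_nat_le_iff, simp)
  also have "\<dots> = 2 * ln (real X) + real (X div 7) * ln 4 + real s * ln (real X)"
    using X by (simp add: ln_mult_pos ln_realpow)
  finally have "2 * (real a * ln 2) \<le> 2 * ln (real X) + 2 * (real (X div 7) * ln 2) + real s * ln (real X)"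
    by (simp only: of_nat_power of_nat_numeral ln_realpow zero_less_numeral ln_4 mult.left_commute [of _ 2])
  moreover have "real (X div 7) * ln 2 \<le> 6 / 7 * (real a * ln 2)"
    unfolding mult.assoc [symmetric] using of_nat_div_le_of_nat[of X 7, where ?'a = real]
    by (intro mult_right_mono) (auto simp: X_def)
  moreover have "real s * ln (real X) + 5 * ln (real X) + 3 \<le> 2 / 100 * real X"
    using sqrt_mult_ln_le[OF X s(2)] by (simp only: distrib_right)
  moreover have "ln (real X) \<ge> 0" using X by simp
  moreover have "real a * ln 2 \<ge> real a * (693 / 1000)" using ln_2_ge by (intro mult_left_mono) auto
  moreover have "real X = 6 * real a" "real a > 0" using a by (simp_all add: X_def)
  \<comment> \<open>What remains is \<open>2 / 7 * a * ln 2 <= 12 / 100 * a\<close>, while the left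
    side is at least \<open>198 / 1000 * a\<close>.\<close>
  ultimately show False by linarith
qed

text \<open>For \<open>k >= 5\<close>, if no such prime exists, all primes in
  \<open>{3 * a<..6 * a}\<close> except possibly \<open>k\<close>, \<open>3 * a + 1\<close> and
  \<open>3 * a + 2\<close> are 1 modulo \<open>k\<close>. The lower bound for all primes then
  contradicts the upper bound for those.\<close>

lemma exists_prime_not_1_mod_large:
  fixes n k :: nat
  assumes n: "n \<ge> 500001" and k: "prime k" "odd k"
  shows "\<exists>p. prime p \<and> n < p \<and> p \<le> 2 * n \<and> p \<noteq> k \<and> \<not> k dvd p - 1"
proof (cases "k = 3")
  case True
  obtain p where p: "prime p" "n < p" "p \<le> 2 * n" "p mod 3 = 2"
    using exists_prime_2_mod_3[OF n] by blast
  have "\<not> 3 dvd p - 1" using p by presburger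
  thus ?thesis using p n True by auto
next
  case False
  have "k \<ge> 5"
  proof (rule ccontr)
    assume "\<not> k \<ge> 5"
    hence "k \<in> {2, 4}" using prime_ge_2_nat[OF k(1)] False by auto
    thus False using k by auto
  qed
  show ?thesis
  proof (rule ccontr)
    assume none: "\<not> ?thesis"
    define a where "a = n div 3"
    define X where "X = 6 * a"
    define P where "P = {p. prime p \<and> X < 2 * p \<and> p \<le> X}"
    define P1 where "P1 = {p. prime p \<and> X < 2 * p \<and> p \<le> X \<and> k dvd p - 1}"
    have a: "a \<ge> 166667" "3 * a \<le> n" "n \<le> 3 * a + 2" using n by (auto simp: a_def)
    have X: "real X \<ge> 10 ^ 6" using a by (simp add: X_def)
    obtain s where s: "X < (s + 1)\<^sup>2" "real s \<le> sqrt (real X)"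
      using exists_floor_sqrt by blast
    have "P - P1 \<subseteq> {k, 3 * a + 1, 3 * a + 2}"
    proof
      fix p assume p: "p \<in> P - P1"
      hence "prime p" "p \<le> 2 * n" "\<not> k dvd p - 1" "3 * a < p" using a by (auto simp: P_def P1_def X_def)
      hence "p \<le> n \<or> p = k" using none not_le by blast
      thus "p \<in> {k, 3 * a + 1, 3 * a + 2}" using \<open>3 * a < p\<close> a by simp linarith
    qed
    hence "\<Prod>(P - P1) \<le> X ^ 3"
      by (rule prod_le_power_card) (use a in \<open>auto simp: P_def X_def card_insert_if\<close>)
    moreover define Q where "Q = \<Prod>P1"
    moreover have "\<Prod>P = \<Prod>(P - P1) * \<Prod>P1"
      by (rule prod.subset_diff) (auto simp: P_def P1_def)
    ultimately have "\<Prod>P \<le> X ^ 3 * Q" by simp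
    have "Q > 0" unfolding Q_def by (auto intro!: prod_pos simp: P1_def prime_gt_0_nat)
    have "16 ^ a \<le> X * \<Prod>P * 4 ^ (X div 7) * X ^ s"
      using prod_primes_ge[of a s] a s unfolding P_def X_def by simp
    also have "\<dots> \<le> X * (X ^ 3 * Q) * 4 ^ (X div 7) * X ^ s"
      by (intro mult_le_mono order.refl \<open>\<Prod>P \<le> X ^ 3 * Q\<close>)
    finally have "ln (real (16 ^ a)) \<le> ln (real (X * (X ^ 3 * Q) * 4 ^ (X div 7) * X ^ s))"
      by (intro ln_mono) (simp_all only: of_nat_le_iff, simp)
    also have "ln (real (X * (X ^ 3 * Q) * 4 ^ (X div 7) * X ^ s)) = ln (real X) + (3 * ln (real X) + ln (real Q))
        + real (X div 7) * ln 4 + real s * ln (real X)"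
      using X \<open>Q > 0\<close> by (simp add: ln_mult_pos ln_realpow)
    finally have "4 * (real a * ln 2) \<le> ln (real X) + (3 * ln (real X) + ln (real Q))
        + 2 * (real (X div 7) * ln 2) + real s * ln (real X)"
      by (simp only: of_nat_power of_nat_numeral ln_realpow zero_less_numeral ln_4 ln_16
            mult.left_commute [of _ 2] mult.left_commute [of _ 4])
    moreover have "real (X div 7) * ln 2 \<le> 6 / 7 * (real a * ln 2)"
      unfolding mult.assoc [symmetric] using of_nat_div_le_of_nat[of X 7, where ?'a = real]
      by (intro mult_right_mono) (auto simp: X_def)
    moreover have "ln (real Q) \<le> 1446 / 1000 * real a + ln (real X) + 3"
    proof (cases "k \<le> 3 * a")
      case True
      have "ln (real Q) \<le> 1446 / 1000 * real a + ln (18 * real a) + 141 / 100"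
        unfolding Q_def P1_def X_def using k(1) \<open>k \<ge> 5\<close> True by (rule prod_primes_1_mod_le_linear)
      moreover have "ln (18 * real a) = ln 3 + ln (real X)"
        using a ln_mult_pos[of 3 "6 * real a"] by (simp add: X_def)
      moreover have "ln (3 :: real) \<le> ln 4" by (intro ln_mono) auto
      hence "ln (3 :: real) \<le> 2 * ln 2" unfolding ln_4 .
      ultimately show ?thesis using ln2_le_25_over_36 by simp
    next
      case False
      \<comment> \<open>An odd prime that is 1 modulo \<open>k\<close> exceeds \<open>2 * k\<close>,
        hence \<open>6 * a\<close>.\<close>
      have "P1 = {}"
      proof (rule ccontr)
        assume "P1 \<noteq> {}"
        then obtain p where p: "prime p" "X < 2 * p" "p \<le> X" "k dvd p - 1"
          by (auto simp: P1_def)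
        have "odd p" using p a prime_odd_nat[of p] by (simp add: X_def)
        hence "2 dvd p - 1" by simp
        moreover have "coprime 2 k" using k by simp
        ultimately have "2 * k dvd p - 1" using p(4) by (intro divides_mult)
        hence "2 * k \<le> p - 1" using p a by (intro dvd_imp_le) (auto simp: X_def)
        thus False using p False by (simp add: X_def)
      qed
      thus ?thesis using X by (simp add: Q_def)
    qed
    moreover have "real s * ln (real X) + 5 * ln (real X) + 3 \<le> 2 / 100 * real X"
      using sqrt_mult_ln_le[OF X s(2)] by (simp only: distrib_right)
    moreover have "real a * ln 2 \<ge> real a * (693 / 1000)" using ln_2_ge by (intro mult_left_mono) auto
    moreover have "real X = 6 * real a" "real a > 0" using a by (simp_all add: X_def)
    \<comment> \<open>The left side keeps \<open>16 / 7 * a * ln 2\<close>, at least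
      \<open>1584 / 1000 * a\<close>; the right side has \<open>1446 / 1000 * a\<close> and errors
      below \<open>120 / 1000 * a\<close>.\<close>
    ultimately show False by linarith
  qed
qed

text \<open>Trial division by \<open>d, d + 2, d + 6, d + 8, ...\<close> for \<open>d mod 6 = 5\<close>; these conditional equations make
  it executable by the simplifier.\<close>

definition no_divisor_from :: "nat \<Rightarrow> nat \<Rightarrow> bool" where
  "no_divisor_from d n \<longleftrightarrow>
     (\<forall>e. odd e \<longrightarrow> \<not> 3 dvd e \<longrightarrow> d \<le> e \<longrightarrow> e * e \<le> n \<longrightarrow> \<not> e dvd n)"

lemma no_divisor_from_stop:
  assumes "n < d * d"
  shows "no_divisor_from d n"
proof -
  have "n < e * e" if "d \<le> e" for e
    using assms that mult_le_mono[of d e d e] by linarith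
  thus ?thesis by (auto simp: no_divisor_from_def not_le [symmetric])
qed

lemma no_divisor_from_step:
  assumes "d mod 6 = 5" "n mod d \<noteq> 0" "n mod (d + 2) \<noteq> 0" "d * d \<le> n"
  shows "no_divisor_from d n \<longleftrightarrow> no_divisor_from (d + 6) n"
proof -
  obtain t where t: "d = 6 * t + 5"
    using assms(1) by (metis mult_div_mod_eq)
  have "e = d \<or> e = d + 2 \<or> d + 6 \<le> e" if "d \<le> e" "odd e" "\<not> 3 dvd e" for e
  proof (rule ccontr)
    assume "\<not> ?thesis"
    hence "e = 6 * t + 6 \<or> e = 6 * t + 8 \<or> e = 6 * t + 9 \<or> e = 6 * t + 10"
      using that(1) t by linarith
    moreover have "3 dvd 6 * t + 9" by presburger
    ultimately show False using that(2,3) by auto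
  qed
  moreover have "\<not> d dvd n" "\<not> d + 2 dvd n" using assms by (simp_all add: dvd_eq_mod_eq_0)
  moreover have "d \<le> e" if "d + 6 \<le> e" for e using that by simp
  ultimately show ?thesis unfolding no_divisor_from_def by blast
qed

lemma prime_if_no_divisor:
  assumes "n > 1" "odd n" "n mod 3 \<noteq> 0" "no_divisor_from 5 n"
  shows "prime n"
  unfolding prime_divisor_sqrt
proof (intro conjI allI impI)
  fix d assume d: "d dvd n \<and> d\<^sup>2 \<le> n"
  have "odd d" using d assms(2) dvd_trans by blast
  moreover have "\<not> 3 dvd d" using d assms(3) dvd_trans by (auto simp: dvd_eq_mod_eq_0 [symmetric])
  ultimately have "\<not> 5 \<le> d"
    using d assms(4) by (auto simp: no_divisor_from_def power2_eq_square)
  hence "d \<in> {0, 1, 2, 3, 4}" by auto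
  thus "d = 1" using \<open>odd d\<close> \<open>\<not> 3 dvd d\<close> by auto
qed (use assms in auto)

section \<open>Small \<open>n\<close>: a chain of prime pairs\<close>

text \<open>If both primes failed, \<open>k\<close> would divide \<open>p * (p - 1)\<close> and
  \<open>p' * (p' - 1)\<close>, hence the power of 2 that is a combination of them.\<close>

lemma prime_pair_not_1_mod:
  fixes p p' u u' k e :: nat
  assumes "p * (p - 1) * u = p' * (p' - 1) * u' + 2 ^ e" "prime k" "odd k"
  shows "(p \<noteq> k \<and> \<not> k dvd p - 1) \<or> (p' \<noteq> k \<and> \<not> k dvd p' - 1)"
proof (rule ccontr)
  assume "\<not> ?thesis"
  hence "k dvd p * (p - 1) * u" "k dvd p' * (p' - 1) * u'" by auto
  hence "k dvd 2 ^ e" unfolding assms(1) by (simp only: dvd_add_right_iff)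
  hence "k dvd 2" using assms(2) prime_dvd_power by blast
  thus False using assms(2,3) primes_dvd_imp_eq[of k 2] by auto
qed

text \<open>One link of the chain: a lower bound on \<open>n\<close> that ensures
  \<open>p' <= 2 * n\<close> improves to \<open>n >= p\<close>, since otherwise both primes lie in
  \<open>{n<..2 * n}\<close>.\<close>

lemma prime_pair_le_of_none:
  fixes p p' u u' n k e :: nat
  assumes k: "prime k" "odd k"
    and none: "\<not> (\<exists>p. prime p \<and> n < p \<and> p \<le> 2 * n \<and> p \<noteq> k \<and> \<not> k dvd p - 1)"
    and bezout: "p * (p - 1) * u = p' * (p' - 1) * u' + 2 ^ e"
    and p: "prime p" "prime p'" "p \<le> p'" "p' \<le> 2 * n"
  shows "p \<le> n"
proof (rule ccontr)
  assume "\<not> p \<le> n"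
  hence "n < p" "n < p'" "p \<le> 2 * n" using p by linarith+
  thus False using prime_pair_not_1_mod[OF bezout k] none p by blast
qed

lemma primes_near_doubling_1:
  "prime (7 :: nat)" "prime (11 :: nat)" "prime (13 :: nat)" "prime (17 :: nat)"
  "prime (19 :: nat)" "prime (29 :: nat)" "prime (31 :: nat)" "prime (47 :: nat)"
  "prime (53 :: nat)" "prime (83 :: nat)" "prime (89 :: nat)" "prime (149 :: nat)"
  "prime (163 :: nat)"
  by simp_all

lemma primes_near_doubling_2:
  "prime (283 :: nat)" "prime (293 :: nat)" "prime (557 :: nat)" "prime (563 :: nat)"
  "prime (1103 :: nat)" "prime (1109 :: nat)" "prime (2153 :: nat)" "prime (2203 :: nat)"
  by (rule prime_if_no_divisor; simp add: no_divisor_from_stop no_divisor_from_step)+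

lemma primes_near_doubling_3:
  "prime (4289 :: nat)" "prime (4297 :: nat)" "prime (8563 :: nat)" "prime (8573 :: nat)"
  "prime (17117 :: nat)" "prime (17123 :: nat)" "prime (34213 :: nat)"
  "prime (34217 :: nat)"
  by (rule prime_if_no_divisor; simp add: no_divisor_from_stop no_divisor_from_step)+

lemma primes_near_doubling_4:
  "prime (68389 :: nat)" "prime (68399 :: nat)" "prime (136769 :: nat)"
  "prime (136777 :: nat)" "prime (273521 :: nat)" "prime (273527 :: nat)"
  "prime (547021 :: nat)" "prime (547037 :: nat)"
  by (rule prime_if_no_divisor; simp add: no_divisor_from_stop no_divisor_from_step)+

lemma exists_prime_not_1_mod:
  fixes n k :: nat
  assumes n: "n \<ge> 6" and k: "prime k" "odd k"
  shows "\<exists>p. prime p \<and> n < p \<and> p \<le> 2 * n \<and> p \<noteq> k \<and> \<not> k dvd p - 1"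
proof (rule ccontr)
  assume none: "\<not> ?thesis"
  note primes = primes_near_doubling_1 primes_near_doubling_2
    primes_near_doubling_3 primes_near_doubling_4
  note step = prime_pair_le_of_none[OF k none]
  \<comment> \<open>In each step \<open>p u p' u' e\<close>, the prime \<open>p'\<close> is at most twice the preceding bound on \<open>n\<close>, and \<open>u\<close>, \<open>u'\<close> are
    Bezout coefficients of \<open>p * (p - 1)\<close> and \<open>p' * (p' - 1)\<close>, whose gcd is \<open>2 ^ e\<close>.\<close>
  have n: "n \<ge> 7" by (rule step[of 7 21 11 8 1]) (use n in \<open>simp_all add: primes del: prime_nat_numeral_eq\<close>)
  have n: "n \<ge> 11" by (rule step[of 11 61 13 43 1]) (use n in \<open>simp_all add: primes del: prime_nat_numeral_eq\<close>)
  have n: "n \<ge> 17" by (rule step[of 17 127 19 101 1]) (use n in \<open>simp_all add: primes del: prime_nat_numeral_eq\<close>)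
  have n: "n \<ge> 29" by (rule step[of 29 331 31 289 1]) (use n in \<open>simp_all add: primes del: prime_nat_numeral_eq\<close>)
  have n: "n \<ge> 47" by (rule step[of 47 631 53 495 1]) (use n in \<open>simp_all add: primes del: prime_nat_numeral_eq\<close>)
  have n: "n \<ge> 83" by (rule step[of 83 2687 89 2335 1]) (use n in \<open>simp_all add: primes del: prime_nat_numeral_eq\<close>)
  have n: "n \<ge> 149" by (rule step[of 149 2341 163 1955 1]) (use n in \<open>simp_all add: primes del: prime_nat_numeral_eq\<close>)
  have n: "n \<ge> 283" by (rule step[of 283 41915 293 39098 1]) (use n in \<open>simp_all add: primes del: prime_nat_numeral_eq\<close>)
  have n: "n \<ge> 557" by (rule step[of 557 117533 563 115039 1]) (use n in \<open>simp_all add: primes del: prime_nat_numeral_eq\<close>)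
  have n: "n \<ge> 1103" by (rule step[of 1103 333545 1109 329944 1]) (use n in \<open>simp_all add: primes del: prime_nat_numeral_eq\<close>)
  have n: "n \<ge> 2153" by (rule step[of 2153 1178878 2203 1125961 1]) (use n in \<open>simp_all add: primes del: prime_nat_numeral_eq\<close>)
  have n: "n \<ge> 4289" by (rule step[of 4289 1831477 4297 1824663 3]) (use n in \<open>simp_all add: primes del: prime_nat_numeral_eq\<close>)
  have n: "n \<ge> 8563" by (rule step[of 8563 29320907 8573 29252540 1]) (use n in \<open>simp_all add: primes del: prime_nat_numeral_eq\<close>)
  have n: "n \<ge> 17117" by (rule step[of 17117 4188612 17123 4185677 1]) (use n in \<open>simp_all add: primes del: prime_nat_numeral_eq\<close>)
  have n: "n \<ge> 34213" by (rule step[of 34213 19517377 34217 19512814 2]) (use n in \<open>simp_all add: primes del: prime_nat_numeral_eq\<close>)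
  have n: "n \<ge> 68389" by (rule step[of 68389 604878473 68399 604701617 1]) (use n in \<open>simp_all add: primes del: prime_nat_numeral_eq\<close>)
  have n: "n \<ge> 136769" by (rule step[of 136769 1187801863 136777 1187662919 3]) (use n in \<open>simp_all add: primes del: prime_nat_numeral_eq\<close>)
  have n: "n \<ge> 273521" by (rule step[of 273521 34201946331 273527 34200445859 1]) (use n in \<open>simp_all add: primes del: prime_nat_numeral_eq\<close>)
  have n: "n \<ge> 547021" by (rule step[of 547021 37919534900 547037 37917316753 2]) (use n in \<open>simp_all add: primes del: prime_nat_numeral_eq\<close>)
  \<comment> \<open>The last prime 547021 lies beyond the threshold of the analytic
    estimate.\<close>
  have "n \<ge> 500001" using n by simp
  thus False using none exists_prime_not_1_mod_large[OF _ k] by blast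
qed

section \<open>Divisibility of sums of odd powers\<close>

text \<open>As \<open>l\<close> is odd, \<open>m ^ l\<close> is congruent to \<open>y ^ l\<close>
  for \<open>y = p - q\<close>. Since \<open>l\<close> is coprime to \<open>p - 1\<close>, an
  inverse exponent \<open>u\<close> and Fermat's theorem remove the power.\<close>

lemma dvd_add_odd_powers_cancel:
  fixes p m q k s :: nat
  assumes p: "prime p" "q < p" "q > 0" "p > 2" and k: "prime k" "odd k" "\<not> k dvd p - 1"
    and dvd: "p dvd m ^ (k ^ s) + q ^ (k ^ s)"
  shows "p dvd m + q"
proof -
  define l where "l = k ^ s"
  define y where "y = p - q"
  have y: "y + q = p" using p by (simp add: y_def)
  have ndvd_y: "\<not> p dvd y" using p y by (auto dest!: dvd_imp_le)
  have "odd l" using k by (simp add: l_def)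
  have "p dvd y ^ l + q ^ l"
  proof -
    have "[int y = - int q] (mod int p)"
      using y by (simp add: cong_iff_dvd_diff flip: of_nat_add)
    hence "[int y ^ l = (- int q) ^ l] (mod int p)" by (rule cong_pow)
    hence "int p dvd int (y ^ l + q ^ l)"
      using \<open>odd l\<close> by (simp add: cong_iff_dvd_diff)
    thus ?thesis by (simp only: of_nat_dvd_iff)
  qed
  hence "[m ^ l + q ^ l = y ^ l + q ^ l] (mod p)"
    using dvd unfolding l_def [symmetric] by (simp add: cong_def mod_eq_0_iff_dvd)
  hence ml: "[m ^ l = y ^ l] (mod p)" by (simp only: cong_add_rcancel_nat)
  have "l > 0" using k by (simp add: l_def prime_gt_0_nat)
  have "\<not> p dvd m"
  proof
    assume "p dvd m"
    hence "p dvd m ^ l" using \<open>l > 0\<close> by (intro dvd_power_le[of p m 1 l, simplified]) auto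
    hence "p dvd y ^ l" using cong_dvd_iff[OF ml] by blast
    thus False using ndvd_y p prime_dvd_power by blast
  qed
  have "coprime k (p - 1)" using k by (intro prime_imp_coprime)
  hence "coprime l (p - 1)" by (simp add: l_def)
  moreover have "p - 1 \<noteq> 1" using p by simp
  ultimately obtain u w where uw: "l * u = (p - 1) * w + 1"
    using coprime_bezout_strong by blast
  have fermat: "[x ^ (l * u) = x] (mod p)" if "\<not> p dvd x" for x
  proof -
    have "[x ^ (p - 1) = 1] (mod p)" using p that by (intro fermat_theorem)
    hence "[(x ^ (p - 1)) ^ w * x = 1 ^ w * x] (mod p)" by (intro cong_mult cong_pow cong_refl)
    moreover have "x ^ (l * u) = (x ^ (p - 1)) ^ w * x"
      by (simp only: uw power_add power_mult power_one_right)
    ultimately show ?thesis by simp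
  qed
  have "[m = m ^ (l * u)] (mod p)" using fermat[OF \<open>\<not> p dvd m\<close>] by (rule cong_sym)
  also have "[m ^ (l * u) = y ^ (l * u)] (mod p)"
    unfolding power_mult using ml by (rule cong_pow)
  also have "[y ^ (l * u) = y] (mod p)" using fermat[OF ndvd_y] .
  finally have "[m = y] (mod p)" .
  hence "[m + q = y + q] (mod p)" by (intro cong_add cong_refl)
  thus ?thesis unfolding y by (simp add: cong_dvd_iff)
qed

lemma power_add_eq_linear:
  fixes x y :: "'a :: comm_ring_1"
  shows "\<exists>c. (x + y) ^ Suc l = x ^ Suc l + of_nat (Suc l) * y * x ^ l + y ^ 2 * c"
proof (induction l)
  case 0
  show ?case by (rule exI[of _ 0]) simp
next
  case (Suc l)
  then obtain c where c: "(x + y) ^ Suc l = x ^ Suc l + of_nat (Suc l) * y * x ^ l + y ^ 2 * c"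
    by blast
  have "(x + y) ^ Suc (Suc l) = (x + y) * (x ^ Suc l + of_nat (Suc l) * y * x ^ l + y ^ 2 * c)"
    by (subst power_Suc) (simp only: c)
  also have "\<dots> = x ^ Suc (Suc l) + of_nat (Suc (Suc l)) * y * x ^ Suc l
      + y ^ 2 * (of_nat (Suc l) * x ^ l + (x + y) * c)"
    by (simp add: algebra_simps power2_eq_square)
  finally show ?case by blast
qed

text \<open>Expanding \<open>m ^ l = (- q + p) ^ l\<close> for odd \<open>l\<close> shows that the
  sum is \<open>l * p * q ^ (l - 1)\<close> modulo \<open>p ^ 2\<close>, and \<open>p\<close>
  divides neither \<open>l\<close> nor \<open>q\<close>.\<close>

lemma prime_square_not_dvd_sum_powers:
  fixes p m q l :: nat
  assumes p: "prime p" "m + q = p" "m > 0" "q > 0" and l: "odd l" "\<not> p dvd l"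
  shows "p dvd m ^ l + q ^ l" "\<not> p\<^sup>2 dvd m ^ l + q ^ l"
proof -
  obtain l' where l': "l = Suc l'" using l(1) by (cases l) auto
  obtain c where c: "(- int q + int p) ^ l = (- int q) ^ l + int l * int p * (- int q) ^ l' + int p ^ 2 * c"
    using power_add_eq_linear[of "- int q" "int p" l'] unfolding l' by auto
  have "- int q + int p = int m" using p by simp
  moreover have "(- int q) ^ l = - (int q ^ l)" "(- int q) ^ l' = int q ^ l'"
    using l(1) l' by simp_all
  ultimately have "int m ^ l + int q ^ l = int l * int p * int q ^ l' + int p ^ 2 * c"
    using c by simp
  hence eq: "int (m ^ l + q ^ l) = int p * (int l * int q ^ l' + int p * c)"
    by (simp add: algebra_simps power2_eq_square)
  hence "int p dvd int (m ^ l + q ^ l)" by (metis dvd_triv_left)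
  thus "p dvd m ^ l + q ^ l" by (simp only: of_nat_dvd_iff)
  show "\<not> p\<^sup>2 dvd m ^ l + q ^ l"
  proof
    assume "p\<^sup>2 dvd m ^ l + q ^ l"
    hence "int (p\<^sup>2) dvd int (m ^ l + q ^ l)" by (simp only: of_nat_dvd_iff)
    hence "int p * int p dvd int p * (int l * int q ^ l' + int p * c)"
      unfolding eq by (simp add: power2_eq_square)
    hence "int p dvd int l * int q ^ l' + int p * c"
      using p(1) prime_gt_0_nat by simp
    hence "int p dvd int l * int q ^ l'" by (simp add: dvd_add_left_iff)
    hence "int p dvd int (l * q ^ l')" by simp
    hence "p dvd l * q ^ l'" by (simp only: of_nat_dvd_iff)
    hence "p dvd q" using p(1) l(2) prime_dvd_power by (auto simp: prime_dvd_mult_iff)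
    thus False using p by (auto dest!: dvd_imp_le)
  qed
qed

lemma prime_square_not_dvd_prod:
  fixes f :: "'a \<Rightarrow> nat"
  assumes "finite A" "a \<in> A" "prime p" "\<not> p\<^sup>2 dvd f a" "\<And>x. x \<in> A - {a} \<Longrightarrow> \<not> p dvd f x"
  shows "\<not> p\<^sup>2 dvd prod f A"
proof
  assume "p\<^sup>2 dvd prod f A"
  hence "p\<^sup>2 dvd f a * prod f (A - {a})" using prod.remove[OF assms(1,2), of f] by simp
  moreover have "coprime p (prod f (A - {a}))"
    using assms(3,5) by (intro prod_coprime_right prime_imp_coprime)
  hence "coprime (p\<^sup>2) (prod f (A - {a}))" by simp
  ultimately have "p\<^sup>2 dvd f a" by (simp add: coprime_dvd_mult_left_iff)
  thus False using assms(4) by simp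
qed

text \<open>The factor \<open>i = p - q\<close> contains \<open>p\<close> exactly once. Any other
  factor divisible by \<open>p\<close> would need \<open>p dvd i + q\<close>, but \<open>p\<close>
  is the only positive multiple of \<open>p\<close> up to \<open>n + q\<close>.\<close>

lemma not_powerful_prod_sum_powers:
  fixes q n k s p :: nat
  assumes p: "prime p" "p \<noteq> k" "\<not> k dvd p - 1" "q < p" "2 < p" "p \<le> n + q" "n + q < 2 * p"
    and k: "prime k" "odd k" and "q > 0"
  shows "\<not> powerful_number (\<Prod>i = 1..n. i ^ (k ^ s) + q ^ (k ^ s))"
proof -
  define m where "m = p - q"
  have m: "m + q = p" "m \<in> {1..n}" using p by (auto simp: m_def)
  have "\<not> p dvd k ^ s"
    using p(1,2) k(1) prime_dvd_power primes_dvd_imp_eq by blast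
  moreover have "odd (k ^ s)" using k by simp
  ultimately have pm: "p dvd m ^ (k ^ s) + q ^ (k ^ s)" "\<not> p\<^sup>2 dvd m ^ (k ^ s) + q ^ (k ^ s)"
    using prime_square_not_dvd_sum_powers[of p m q "k ^ s"] m p(1) \<open>q > 0\<close> by auto
  have "\<not> p dvd i ^ (k ^ s) + q ^ (k ^ s)" if i: "i \<in> {1..n} - {m}" for i
  proof
    assume "p dvd i ^ (k ^ s) + q ^ (k ^ s)"
    hence "p dvd i + q"
      by (rule dvd_add_odd_powers_cancel[OF p(1,4) \<open>q > 0\<close> p(5) k p(3)])
    then obtain c where c: "i + q = p * c" by (elim dvdE)
    have "p * c < p * 2" unfolding c [symmetric] using i p by simp
    hence "c < 2" by (simp only: mult_less_cancel1)
    moreover have "c \<noteq> 0" using c i by (intro notI) simp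
    ultimately have "c = 1" by simp
    thus False using c i m by simp
  qed
  hence "\<not> p\<^sup>2 dvd (\<Prod>i = 1..n. i ^ (k ^ s) + q ^ (k ^ s))"
    using m(2) p(1) pm(2) by (intro prime_square_not_dvd_prod[of _ m]) auto
  moreover have "p dvd (\<Prod>i = 1..n. i ^ (k ^ s) + q ^ (k ^ s))"
    using pm(1) m(2) dvd_prodI[of "{1..n}" m "\<lambda>i. i ^ (k ^ s) + q ^ (k ^ s)"] dvd_trans by blast
  ultimately show ?thesis using p(1) unfolding powerful_number_def by blast
qed

theorem theorem1:
  fixes q l n :: nat
  assumes "q > 0"
    and "odd_prime_power l"
    and "int n \<ge> max (int q) (11 - int q)"
  shows "\<not> powerful_number (\<Prod>i = 1..n. i ^ l + q ^ l)"
proof -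
  obtain k s where k: "prime k" "odd k" and l: "l = k ^ s"
    using assms(2) by (auto simp: odd_prime_power_def)
  have qn: "q \<le> n" "11 \<le> n + q" using assms(3) by linarith+
  have "\<exists>p. prime p \<and> p \<noteq> k \<and> \<not> k dvd p - 1 \<and> q < p \<and> 2 < p \<and> p \<le> n + q \<and> n + q < 2 * p"
  proof (cases "n + q = 11")
    case True
    \<comment> \<open>Rounding down would leave only 7 in \<open>{5<..10}\<close>, which fails for
      \<open>k = 3\<close>; hence 11 is used as well.\<close>
    have "prime (7 :: nat)" "prime (11 :: nat)" by simp_all
    moreover have "(7 \<noteq> k \<and> \<not> k dvd 7 - 1) \<or> (11 \<noteq> k \<and> \<not> k dvd 11 - 1)"
      by (rule prime_pair_not_1_mod[of 7 21 11 8 1]) (use k in simp_all)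
    moreover have "q < 7" using True qn by simp
    ultimately show ?thesis using True by (elim disjE) (auto intro: exI[of _ 7] exI[of _ 11])
  next
    case False
    define N where "N = (n + q) div 2"
    have N: "N \<ge> 6" "2 * N \<le> n + q" "n + q \<le> 2 * N + 1" "q \<le> N"
      using False qn by (simp_all add: N_def)
    obtain p where "prime p" "N < p" "p \<le> 2 * N" "p \<noteq> k" "\<not> k dvd p - 1"
      using exists_prime_not_1_mod[OF N(1) k] by blast
    \<comment> \<open>Rounding is harmless: \<open>p >= N + 1\<close> gives
      \<open>2 * p >= 2 * N + 2 > n + q\<close>.\<close>
    moreover have "q < p" "2 < p" "p \<le> n + q" "n + q < 2 * p"
      using calculation N by linarith+
    ultimately show ?thesis by blast
  qed
  then obtain p where "prime p" "p \<noteq> k" "\<not> k dvd p - 1" "q < p" "2 < p" "p \<le> n + q" "n + q < 2 * p"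
    by blast
  thus ?thesis unfolding l using k \<open>q > 0\<close> by (rule not_powerful_prod_sum_powers)
qed

end
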